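(* Let $f:\mathbb{GA}_N\to\mathbb{G\overline A}{}_N$ be an equitorsion almost geodesic mapping of the type $\underset{2}{\pi}{}_3$, with basic equations $$\overline L{}^i_{\underline{jk}}=L^i_{\underline{jk}}+\psi_j\delta^i_k+\psi_k\delta^i_j+2\sigma_{jk}\varphi^i,\qquad \varphi^i_{\underset{2}{|}j}=\underset{2}{\nu}{}_j\varphi^i+\underset{2}{\mu}\,\delta^i_j ,$$ where $\psi_j$ and $\underset{2}{\nu}{}_j$ are $1$-forms, $\sigma_{jk}=\sigma_{kj}$ is a symmetric tensor, $\varphi^i$ is a contravariant vector and $\underset{2}{\mu}$ is a scalar. Then the following hold. (1) The geometrical object $$\underset{2}{\widetilde{\mathcal T}}{}^i_{jk}=L^i_{\underline{jk}}-\frac1{N+1}\delta^i_k\big(L^\alpha_{\underline{j\alpha}}+\sigma_{j\alpha}\varphi^\alpha\big)-\frac1{N+1}\delta^i_j\big(L^\alpha_{\underline{k\alpha}}+\sigma_{k\alpha}\varphi^\alpha\big)+\sigma_{jk}\varphi^i$$ is an invariant (the basic invariant of the Thomas type) for the mapping $f$. The invariance of this geometrical object is total. (2) The geometrical object $$\begin{aligned} \underset{2}{\widetilde{\mathcal W}}{}^i_{jmn}&=R^i_{jmn}+\frac1{N+1}\delta^i_j\Big(R_{[mn]}-\big(\sigma_{[m\alpha|n]}+\sigma_{[m\beta}L^\beta_{\underset{\vee}{\alpha n}]}+\sigma_{[m\alpha}\underset{2}{\nu}{}_{n]}\big)\varphi^\alpha\Big)\\ &+\sigma_{j[m|n]}\varphi^i+\sigma_{j[m}\sigma_{\alpha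 n]}\varphi^\alpha\varphi^i+\sigma_{j[m}L^i_{\underset{\vee}{\alpha n}]}\varphi^\alpha+\sigma_{j[m}\underset{2}{\nu}{}_{n]}\varphi^i-\delta^i_{[m}\underset{2}{\mu}\,\sigma_{jn]}\\ &-\frac1{N+1}\Big(\delta^i_{[m}L^\alpha_{\underline{j\alpha}|n]}+\big(\delta^i_{[m}\sigma_{j\alpha|n]}+\delta^i_{[m}\sigma_{j\beta}L^\beta_{\underset{\vee}{\alpha n}]}+\delta^i_{[m}\sigma_{j\alpha}\underset{2}{\nu}{}_{n]}\big)\varphi^\alpha+\delta^i_{[m}\underset{2}{\mu}\,\sigma_{jn]}\Big)\\ &+\frac1{N+1}\delta^i_{[m}\sigma_{jn]}\big(L^\beta_{\underline{\alpha\beta}}+\sigma_{\alpha\beta}\varphi^\beta\big)\varphi^\alpha\\ &-\frac1{(N+1)^2}\big(L^\alpha_{\underline{j\alpha}}+\sigma_{j\alpha}\varphi^\alpha\big)\big(\delta^i_{[m}L^\beta_{\underline{n]\beta}}+\delta^i_{[m}\sigma_{n]\beta}\varphi^\beta\big) \end{aligned}$$ is an invariant (the basic associated invariant) for the mapping $f$. The invariance of this geometrical object is valued. It is total if and only if the mapping $f$ has the property of reciprocity. (3) The geometrical object $$\begin{aligned} \underset{2}{\widetilde W}{}^i_{jmn}&=R^i_{jmn}+\frac1{N+1}\delta^i_jR_{[mn]}+\frac N{N^2-1}\delta^i_{[m}R_{jn]}+\frac1{N^2-1}\delta^i_{[m}R_{n]j}\\ &+\sigma_{j[m|n]}\varphi^i+\sigma_{j[m}L^i_{\underset{\vee}{\alpha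 n}]}\varphi^\alpha+\sigma_{j[m}\underset{2}{\nu}{}_{n]}\varphi^i+\sigma_{j[m}\sigma_{\alpha n]}\varphi^\alpha\varphi^i\\ &+\frac1{N-1}\big(\delta^i_{[m}\sigma_{jn]|\alpha}+\delta^i_{[m}\sigma_{jn]}L^\beta_{\underset{\vee}{\alpha\beta}}+\delta^i_{[m}\sigma_{jn]}\underset{2}{\nu}{}_\alpha\big)\varphi^\alpha\\ &+\frac1{N-1}\big(\delta^i_{[m}\sigma_{jn]}\sigma_{\alpha\beta}-\delta^i_{[m}\sigma_{j\alpha}\sigma_{n]\beta}\big)\varphi^\alpha\varphi^\beta\\ &-\frac N{N^2-1}\big(\delta^i_{[m}\sigma_{\alpha j|n]}+\delta^i_{[m}\sigma_{\beta j}L^\beta_{\underset{\vee}{\alpha n}]}+\delta^i_{[m}\sigma_{\alpha j}\underset{2}{\nu}{}_{n]}\big)\varphi^\alpha\\ &-\frac1{N^2-1}\big(\delta^i_{[m}\sigma_{\alpha n]|j}+\delta^i_{[m}\sigma_{\beta n]}L^\beta_{\underset{\vee}{\alpha j}}+\delta^i_{[m}\sigma_{\alpha n]}\underset{2}{\nu}{}_j\big)\varphi^\alpha \end{aligned}$$ is an invariant (the associated derived invariant of the Weyl type) for the mapping $f$. The invariance of this geometrical object is valued. It is total if and only if the mapping $f$ has the property of reciprocity. (4) For all coefficients $u,u'$ and all $p^1=(p^1_1,p^1_2,p^1_3)$, $p^2=(p^2_1,p^2_2,p^2_3)$ with $p^a_b\in\{1,2\}$, the geometrical objects $$\begin{aligned}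 \underset{2}{\mathcal W}{}^i_{0.(p^1).(p^2).jmn}&=\underset{2}{\widetilde{\mathcal W}}{}^i_{jmn}+uL^i_{\underset{\vee}{jm}|n}+u'L^i_{\underset{\vee}{jn}|m}\\ &-u\big(\omega^i_{(p^1_1).\alpha n}L^\alpha_{\underset{\vee}{jm}}-\omega^\alpha_{(p^1_2).jn}L^i_{\underset{\vee}{\alpha m}}-\omega^\alpha_{(p^1_3).mn}L^i_{\underset{\vee}{j\alpha}}\big)\\ &-u'\big(\omega^i_{(p^2_1).\alpha m}L^\alpha_{\underset{\vee}{jn}}-\omega^\alpha_{(p^2_2).jm}L^i_{\underset{\vee}{\alpha n}}-\omega^\alpha_{(p^2_3).mn}L^i_{\underset{\vee}{j\alpha}}\big) \end{aligned}$$ and $$\begin{aligned} \underset{2}{W}{}^i_{0.(p^1).(p^2).jmn}&=\underset{2}{\widetilde W}{}^i_{jmn}+uL^i_{\underset{\vee}{jm}|n}+u'L^i_{\underset{\vee}{jn}|m}\\ &-u\big(\omega^i_{(p^1_1).\alpha n}L^\alpha_{\underset{\vee}{jm}}-\omega^\alpha_{(p^1_2).jn}L^i_{\underset{\vee}{\alpha m}}-\omega^\alpha_{(p^1_3).mn}L^i_{\underset{\vee}{j\alpha}}\big)\\ &-u'\big(\omega^i_{(p^2_1).\alpha m}L^\alpha_{\underset{\vee}{jn}}-\omega^\alpha_{(p^2_2).jm}L^i_{\underset{\vee}{\alpha n}}-\omega^\alpha_{(p^2_3).mn}L^i_{\underset{\vee}{j\alpha}}\big) \end{aligned}$$ are invariants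 for the mapping $f$, where $\omega^i_{(1).jk}=L^i_{\underline{jk}}$, $\omega^i_{(2).jk}=\omega^i_{jk}$ and $$\omega^i_{jk}=\frac1{N+1}\delta^i_k\big(L^\alpha_{\underline{j\alpha}}+\sigma_{j\alpha}\varphi^\alpha\big)+\frac1{N+1}\delta^i_j\big(L^\alpha_{\underline{k\alpha}}+\sigma_{k\alpha}\varphi^\alpha\big)-\sigma_{jk}\varphi^i .$$ The invariance of these geometrical objects is valued. It is total if and only if the mapping $f$ has the property of reciprocity.
   Context: Spaces. A non-symmetric affine connection space $\mathbb{GA}_N$ is an $N$-dimensional manifold ($N>1$) with an affine connection $\nabla$ whose coefficients $L^i_{jk}$ are not symmetric in $j,k$. Put $L^i_{\underline{jk}}=\frac12(L^i_{jk}+L^i_{kj})$ and $L^i_{\underset{\vee}{jk}}=\frac12(L^i_{jk}-L^i_{kj})$. The associated space $\mathbb A_N$ is the manifold with the symmetric connection of coefficients $L^i_{\underline{jk}}$. A mapping $f:\mathbb{GA}_N\to\mathbb{G\overline A}{}_N$ is described in a common coordinate system; the objects of $\mathbb{G\overline A}{}_N$ are denoted by a bar (connection coefficients $\overline L{}^i_{jk}$). Repeated indices are summed; a comma denotes partial derivative. Covariant derivatives. The covariant derivative in $\mathbb A_N$ is $a^i_{j|k}=a^i_{j,k}+L^i_{\underline{\alpha k}}a^\alpha_j-L^\alpha_{\underline{jk}}a^i_\alpha$ (similarly for other valences; $\|$ denotes the one in $\overline{\mathbb A}_N$). The covariant derivative of the second kind in $\mathbb{GA}_N$ is $a^i_{j\underset{2}{|}k}=a^i_{j,k}+L^i_{k\alpha}a^\alpha_j-L^\alpha_{kj}a^i_\alpha$;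 in particular $\varphi^i_{\underset{2}{|}j}=\varphi^i_{,j}+L^i_{j\alpha}\varphi^\alpha$. One uses the notation $L^i_{\underline{jm}|n}=L^i_{\underline{jm},n}+L^i_{\underline{\alpha n}}L^\alpha_{\underline{jm}}-L^\alpha_{\underline{jn}}L^i_{\underline{\alpha m}}-L^\alpha_{\underline{mn}}L^i_{\underline{j\alpha}}$, and $L^\alpha_{\underline{j\alpha}|n}$ is its contraction in $i$ and $m$. Curvature. $R^i_{jmn}=L^i_{\underline{jm},n}-L^i_{\underline{jn},m}+L^\alpha_{\underline{jm}}L^i_{\underline{\alpha n}}-L^\alpha_{\underline{jn}}L^i_{\underline{\alpha m}}$ is the curvature tensor of $\mathbb A_N$ and $R_{ij}=R^\alpha_{ij\alpha}$ its Ricci tensor. The coefficients $u,u'$ are those of the family of curvature tensors of $\mathbb{GA}_N$, $K^i_{jmn}=R^i_{jmn}+uL^i_{\underset{\vee}{jm}|n}+u'L^i_{\underset{\vee}{jn}|m}+vL^\alpha_{\underset{\vee}{jm}}L^i_{\underset{\vee}{\alpha n}}+v'L^\alpha_{\underset{\vee}{jn}}L^i_{\underset{\vee}{\alpha m}}+wL^\alpha_{\underset{\vee}{mn}}L^i_{\underset{\vee}{\alpha j}}$. Brackets. Square brackets denote antisymmetrization without division, in the two extreme indices inside the bracket only, all other indices remaining fixed: e.g. $R_{[mn]}=R_{mn}-R_{nm}$, $\delta^i_{[m}\sigma_{jn]}=\delta^i_m\sigma_{jn}-\delta^i_n\sigma_{jm}$, $\delta^i_{[m}R_{n]j}=\delta^i_mR_{nj}-\delta^i_nR_{mj}$,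 $\sigma_{j[m|n]}=\sigma_{jm|n}-\sigma_{jn|m}$, $\sigma_{[m\alpha|n]}=\sigma_{m\alpha|n}-\sigma_{n\alpha|m}$, $\sigma_{j[m}L^i_{\underset{\vee}{\alpha n}]}=\sigma_{jm}L^i_{\underset{\vee}{\alpha n}}-\sigma_{jn}L^i_{\underset{\vee}{\alpha m}}$. The vertical bar inside brackets is the covariant derivative in $\mathbb A_N$. Mappings. An almost geodesic mapping is one that takes every geodesic line of $\mathbb{GA}_N$ to an almost geodesic line of $\mathbb{G\overline A}{}_N$; those of type $\underset{2}{\pi}{}_3$ are given by the two basic equations displayed in the claim. The mapping is equitorsion if $\overline L{}^i_{\underset{\vee}{jk}}=L^i_{\underset{\vee}{jk}}$. An almost geodesic mapping of type $\underset{2}{\pi}{}_3$ has the property of reciprocity if its inverse mapping $f^{-1}:\mathbb{G\overline A}{}_N\to\mathbb{GA}_N$ is also an almost geodesic mapping of type $\underset{2}{\pi}{}_3$. For the inverse mapping, the tensor $D^i_{jk}=2\sigma_{jk}\varphi^i$ is replaced by $\overline D{}^i_{jk}=-D^i_{jk}$, so that $L^i_{\underline{jk}}=\overline L{}^i_{\underline{jk}}-\psi_j\delta^i_k-\psi_k\delta^i_j+\overline D{}^i_{jk}$. Invariance. Let $U^{i_1\ldots i_p}_{j_1\ldots j_q}$ be a geometrical object of type $(p,q)$ and $f:\mathbb{GA}_N\to\mathbb{G\overline A}{}_N$ a transformation. If $f$ preserves the value of $U^{i_1\ldots i_p}_{j_1\ldots j_q}$ but changes its form to $\overline V{}^{i_1\ldots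 i_p}_{j_1\ldots j_q}$, the invariance of $U$ under $f$ is called valued. If $f$ preserves both the value and the form of $U^{i_1\ldots i_p}_{j_1\ldots j_q}$ (i.e. $\overline U=U$, with $\overline U$ given by the same formula in the corresponding objects of $\mathbb{G\overline A}{}_N$), the invariance of $U$ under $f$ is called total.
   Formalization: In (3) and the second family of (4), "total iff reciprocity" fails as printed; it is proved as "total iff reciprocity and σ_{mα}φ^α is a closed form", and exactly as printed for the object with the missing term −(1/(N+1))δ^i_j(σ_{[mα|n]}+σ_{[mβ}L^β_{∨αn]}+σ_{[mα}ν_{n]})φ^α added. *)

theory Defs
  imports "HOL-Analysis.Analysis"
begin

text \<open>
  Everything is written in one coordinate domain \<open>U\<close>, an open subset of \<open>real ^ 'n\<close>.  A mapping
  between two connection spaces is described in a common coordinate system, so that a point and its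
  image have the same coordinates: a mapping is given by \<open>U\<close> and the connection coefficients \<open>L\<close>,
  \<open>L'\<close> of its source and target (a prime stands for the bar), and the inverse mapping is obtained
  by exchanging \<open>L\<close> and \<open>L'\<close>.

  The upper index of a component always comes first: \<open>L x i j k\<close> is \<open>L\<^sup>i\<^sub>j\<^sub>k\<close> at \<open>x\<close>.
\<close>

type_synonym 'n conn = "real ^ 'n \<Rightarrow> 'n \<Rightarrow> 'n \<Rightarrow> 'n \<Rightarrow> real"

definition pd :: "'n::finite \<Rightarrow> (real ^ 'n \<Rightarrow> real) \<Rightarrow> real ^ 'n \<Rightarrow> real" where
  "pd n f x = frechet_derivative f (at x) (axis n 1)"

primrec Ck_on :: "nat \<Rightarrow> (real ^ 'n::finite) set \<Rightarrow> (real ^ 'n \<Rightarrow> real) \<Rightarrow> bool" where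
  "Ck_on 0 U f \<longleftrightarrow> continuous_on U f"
| "Ck_on (Suc k) U f \<longleftrightarrow> f differentiable_on U \<and> (\<forall>n. Ck_on k U (pd n f))"

definition smooth_on :: "(real ^ 'n::finite) set \<Rightarrow> (real ^ 'n \<Rightarrow> real) \<Rightarrow> bool" where
  "smooth_on U f \<longleftrightarrow> (\<forall>k. Ck_on k U f)"

definition kron :: "'n \<Rightarrow> 'n \<Rightarrow> real" where
  "kron i j = (if i = j then 1 else 0)"

text \<open>The square bracket: antisymmetrization without division in the two extreme indices.\<close>

definition asym :: "('n \<Rightarrow> 'n \<Rightarrow> real) \<Rightarrow> 'n \<Rightarrow> 'n \<Rightarrow> real" where
  "asym f m n = f m n - f n m"


section \<open>Non-symmetric affine connection spaces\<close>

definition sym_part :: "'n conn \<Rightarrow> 'n conn" where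
  "sym_part L x i j k = (L x i j k + L x i k j) / 2"

definition torsion_part :: "'n conn \<Rightarrow> 'n conn" where
  "torsion_part L x i j k = (L x i j k - L x i k j) / 2"

definition GA_space :: "(real ^ 'n::finite) set \<Rightarrow> 'n conn \<Rightarrow> bool" where
  "GA_space U L \<longleftrightarrow> 1 < CARD('n) \<and> open U \<and> (\<forall>i j k. smooth_on U (\<lambda>x. L x i j k)) \<and>
     (\<exists>x\<in>U. \<exists>i j k. L x i j k \<noteq> L x i k j)"

text \<open>
  Covariant derivatives in the associated symmetric space; the last index is the index of
  differentiation.  Applied to \<open>sym_part L\<close>, which is not a tensor, \<open>cov_12\<close> is the notation
  \<open>L\<^sup>i\<^sub>j\<^sub>m\<^sub>|\<^sub>n\<close> for the symmetric part.
\<close>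

definition cov_02 ::
  "'n::finite conn \<Rightarrow> (real ^ 'n \<Rightarrow> 'n \<Rightarrow> 'n \<Rightarrow> real) \<Rightarrow> real ^ 'n \<Rightarrow> 'n \<Rightarrow> 'n \<Rightarrow> 'n \<Rightarrow> real" where
  "cov_02 L a x j m n = pd n (\<lambda>y. a y j m) x
     - (\<Sum>\<alpha>\<in>UNIV. sym_part L x \<alpha> j n * a x \<alpha> m)
     - (\<Sum>\<alpha>\<in>UNIV. sym_part L x \<alpha> m n * a x j \<alpha>)"

definition cov_12 ::
  "'n::finite conn \<Rightarrow> 'n conn \<Rightarrow> real ^ 'n \<Rightarrow> 'n \<Rightarrow> 'n \<Rightarrow> 'n \<Rightarrow> 'n \<Rightarrow> real" where
  "cov_12 L a x i j m n = pd n (\<lambda>y. a y i j m) x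
     + (\<Sum>\<alpha>\<in>UNIV. sym_part L x i \<alpha> n * a x \<alpha> j m)
     - (\<Sum>\<alpha>\<in>UNIV. sym_part L x \<alpha> j n * a x i \<alpha> m)
     - (\<Sum>\<alpha>\<in>UNIV. sym_part L x \<alpha> m n * a x i j \<alpha>)"

text \<open>Covariant derivative of the second kind of a contravariant vector.\<close>

definition cov2_vec ::
  "'n::finite conn \<Rightarrow> (real ^ 'n \<Rightarrow> 'n \<Rightarrow> real) \<Rightarrow> real ^ 'n \<Rightarrow> 'n \<Rightarrow> 'n \<Rightarrow> real" where
  "cov2_vec L v x i j = pd j (\<lambda>y. v y i) x + (\<Sum>\<alpha>\<in>UNIV. L x i j \<alpha> * v x \<alpha>)"

definition curv :: "'n::finite conn \<Rightarrow> real ^ 'n \<Rightarrow> 'n \<Rightarrow> 'n \<Rightarrow> 'n \<Rightarrow> 'n \<Rightarrow> real" where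
  "curv L x i j m n = pd n (\<lambda>y. sym_part L y i j m) x - pd m (\<lambda>y. sym_part L y i j n) x
     + (\<Sum>\<alpha>\<in>UNIV. sym_part L x \<alpha> j m * sym_part L x i \<alpha> n)
     - (\<Sum>\<alpha>\<in>UNIV. sym_part L x \<alpha> j n * sym_part L x i \<alpha> m)"

definition ricci :: "'n::finite conn \<Rightarrow> real ^ 'n \<Rightarrow> 'n \<Rightarrow> 'n \<Rightarrow> real" where
  "ricci L x i j = (\<Sum>\<alpha>\<in>UNIV. curv L x \<alpha> i j \<alpha>)"


section \<open>Almost geodesic mappings of type \<open>\<pi>\<^sub>3\<close> of the second kind\<close>

record ('n::finite) pi3_data =
  psi :: "real ^ 'n \<Rightarrow> 'n \<Rightarrow> real"
  sigma :: "real ^ 'n \<Rightarrow> 'n \<Rightarrow> 'n \<Rightarrow> real"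
  phi :: "real ^ 'n \<Rightarrow> 'n \<Rightarrow> real"
  nu :: "real ^ 'n \<Rightarrow> 'n \<Rightarrow> real"
  mu :: "real ^ 'n \<Rightarrow> real"

definition smooth_data :: "(real ^ 'n::finite) set \<Rightarrow> 'n pi3_data \<Rightarrow> bool" where
  "smooth_data U d \<longleftrightarrow>
     (\<forall>j. smooth_on U (\<lambda>x. psi d x j)) \<and> (\<forall>j k. smooth_on U (\<lambda>x. sigma d x j k)) \<and>
     (\<forall>i. smooth_on U (\<lambda>x. phi d x i)) \<and> (\<forall>j. smooth_on U (\<lambda>x. nu d x j)) \<and> smooth_on U (mu d)"

definition pi3_mapping ::
  "(real ^ 'n::finite) set \<Rightarrow> 'n conn \<Rightarrow> 'n conn \<Rightarrow> 'n pi3_data \<Rightarrow> bool" where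
  "pi3_mapping U L L' d \<longleftrightarrow> GA_space U L \<and> GA_space U L' \<and> smooth_data U d \<and>
     (\<forall>x\<in>U. \<forall>j k. sigma d x j k = sigma d x k j) \<and>
     (\<forall>x\<in>U. \<forall>i j k. sym_part L' x i j k =
        sym_part L x i j k + psi d x j * kron i k + psi d x k * kron i j
          + 2 * sigma d x j k * phi d x i) \<and>
     (\<forall>x\<in>U. \<forall>i j. cov2_vec L (phi d) x i j = nu d x j * phi d x i + mu d x * kron i j)"

definition equitorsion :: "(real ^ 'n::finite) set \<Rightarrow> 'n conn \<Rightarrow> 'n conn \<Rightarrow> bool" where
  "equitorsion U L L' \<longleftrightarrow> (\<forall>x\<in>U. \<forall>i j k. torsion_part L' x i j k = torsion_part L x i j k)"

definition reciprocity :: "(real ^ 'n::finite) set \<Rightarrow> 'n conn \<Rightarrow> 'n conn \<Rightarrow> bool" where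
  "reciprocity U L L' \<longleftrightarrow> (\<exists>d'. pi3_mapping U L' L d')"

definition D_tensor :: "'n::finite pi3_data \<Rightarrow> 'n conn" where
  "D_tensor d x i j k = 2 * sigma d x j k * phi d x i"

definition D_bar :: "'n::finite pi3_data \<Rightarrow> 'n conn" where
  "D_bar d x i j k = - D_tensor d x i j k"

text \<open>
  \<open>d'\<close> collects the barred objects corresponding to \<open>d\<close>: they satisfy the basic equations of the
  inverse mapping, with \<open>\<psi>\<close> and \<open>D\<close> replaced by their negatives.  The factors of \<open>D = 2 \<sigma> \<phi>\<close> (and
  hence \<open>\<nu>\<close>, \<open>\<mu>\<close>) are not unique, so this is a relation.
\<close>

definition corresponding_data ::
  "(real ^ 'n::finite) set \<Rightarrow> 'n conn \<Rightarrow> 'n conn \<Rightarrow> 'n pi3_data \<Rightarrow> 'n pi3_data \<Rightarrow> bool" where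
  "corresponding_data U L L' d d' \<longleftrightarrow> pi3_mapping U L' L d' \<and>
     (\<forall>x\<in>U. (\<forall>j. psi d' x j = - psi d x j) \<and>
            (\<forall>i j k. D_tensor d' x i j k = D_bar d x i j k))"


section \<open>Invariance\<close>

text \<open>
  A geometrical object is a formula in the connection coefficients and the objects of the mapping;
  its components at a point form a value of type \<open>'c\<close>.
\<close>

type_synonym ('n, 'c) geom_object = "'n conn \<Rightarrow> 'n pi3_data \<Rightarrow> real ^ 'n \<Rightarrow> 'c"
type_synonym 'n geom_object4 = "('n, 'n \<Rightarrow> 'n \<Rightarrow> 'n \<Rightarrow> 'n \<Rightarrow> real) geom_object"

text \<open>
  Total invariance: the barred objects entering the formula exist, and the same formula in them
  (for every admissible choice) has the same value.
\<close>

definition total_invariant ::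
  "(real ^ 'n::finite) set \<Rightarrow> 'n conn \<Rightarrow> 'n conn \<Rightarrow> 'n pi3_data \<Rightarrow> ('n, 'c) geom_object \<Rightarrow> bool" where
  "total_invariant U L L' d F \<longleftrightarrow>
     (\<exists>d'. corresponding_data U L L' d d') \<and>
     (\<forall>d'. corresponding_data U L L' d d' \<longrightarrow> (\<forall>x\<in>U. F L' d' x = F L d x))"

text \<open>
  Valued invariance: the value of the object is also the value of one formula \<open>V\<close>, possibly of a
  different form, in objects of the target space.  \<open>V\<close> is the same for all mappings, and is a local
  expression in the coefficients \<open>L'\<close>, the tensor \<open>D_bar\<close> and their first derivatives.  The form
  \<open>\<psi>\<close> must not enter \<open>V\<close>: from \<open>L'\<close>, \<open>D_bar\<close> and \<open>\<psi>\<close> one recovers \<open>L\<close>, and every object would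
  be a valued invariant.  Total invariance is not excluded.
\<close>

definition jet1 ::
  "'n::finite conn \<Rightarrow> real ^ 'n \<Rightarrow> ('n \<Rightarrow> 'n \<Rightarrow> 'n \<Rightarrow> real) \<times> ('n \<Rightarrow> 'n \<Rightarrow> 'n \<Rightarrow> 'n \<Rightarrow> real)" where
  "jet1 A x = (A x, \<lambda>i j k n. pd n (\<lambda>y. A y i j k) x)"

definition valued_invariant :: "('n::finite, 'c) geom_object \<Rightarrow> bool" where
  "valued_invariant F \<longleftrightarrow>
     (\<exists>V. \<forall>U L L' d. pi3_mapping U L L' d \<and> equitorsion U L L' \<longrightarrow>
        (\<forall>x\<in>U. V (jet1 L' x) (jet1 (D_bar d) x) = F L d x))"


section \<open>The geometrical objects\<close>

definition contr_sym :: "'n::finite conn \<Rightarrow> real ^ 'n \<Rightarrow> 'n \<Rightarrow> real" where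
  "contr_sym L x j = (\<Sum>\<alpha>\<in>UNIV. sym_part L x \<alpha> j \<alpha>)"

definition sigma_phi :: "'n::finite pi3_data \<Rightarrow> real ^ 'n \<Rightarrow> 'n \<Rightarrow> real" where
  "sigma_phi d x j = (\<Sum>\<alpha>\<in>UNIV. sigma d x j \<alpha> * phi d x \<alpha>)"

definition omega :: "'n::finite conn \<Rightarrow> 'n pi3_data \<Rightarrow> real ^ 'n \<Rightarrow> 'n \<Rightarrow> 'n \<Rightarrow> 'n \<Rightarrow> real" where
  "omega L d x i j k =
     1 / (real CARD('n) + 1) * kron i k * (contr_sym L x j + sigma_phi d x j)
   + 1 / (real CARD('n) + 1) * kron i j * (contr_sym L x k + sigma_phi d x k)
   - sigma d x j k * phi d x i"

definition thomas_T :: "('n::finite, 'n \<Rightarrow> 'n \<Rightarrow> 'n \<Rightarrow> real) geom_object" where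
  "thomas_T L d x i j k = sym_part L x i j k
   - 1 / (real CARD('n) + 1) * kron i k * (contr_sym L x j + sigma_phi d x j)
   - 1 / (real CARD('n) + 1) * kron i j * (contr_sym L x k + sigma_phi d x k)
   + sigma d x j k * phi d x i"

definition assoc_W :: "'n::finite geom_object4" where
  "assoc_W L d x i j m n =
    (let N = real CARD('n); R = curv L x; Ric = ricci L x; t = torsion_part L x;
         l = contr_sym L x; \<sigma> = sigma d x; \<sigma>' = cov_02 L (sigma d) x;
         \<phi> = phi d x; \<nu> = nu d x; \<mu> = mu d x
     in R i j m n
      + 1 / (N + 1) * kron i j *
          (asym Ric m n
           - (\<Sum>\<alpha>\<in>UNIV. (asym (\<lambda>m n. \<sigma>' m \<alpha> n) m n
                       + (\<Sum>\<beta>\<in>UNIV. asym (\<lambda>m n. \<sigma> m \<beta> * t \<beta> \<alpha> n) m n)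
                       + asym (\<lambda>m n. \<sigma> m \<alpha> * \<nu> n) m n) * \<phi> \<alpha>))
      + asym (\<lambda>m n. \<sigma>' j m n) m n * \<phi> i
      + (\<Sum>\<alpha>\<in>UNIV. asym (\<lambda>m n. \<sigma> j m * \<sigma> \<alpha> n) m n * \<phi> \<alpha> * \<phi> i)
      + (\<Sum>\<alpha>\<in>UNIV. asym (\<lambda>m n. \<sigma> j m * t i \<alpha> n) m n * \<phi> \<alpha>)
      + asym (\<lambda>m n. \<sigma> j m * \<nu> n) m n * \<phi> i
      - asym (\<lambda>m n. kron i m * \<mu> * \<sigma> j n) m n
      - 1 / (N + 1) *
          ((\<Sum>\<alpha>\<in>UNIV. asym (\<lambda>m n. kron i m * cov_12 L (sym_part L) x \<alpha> j \<alpha> n) m n)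
           + (\<Sum>\<alpha>\<in>UNIV. (asym (\<lambda>m n. kron i m * \<sigma>' j \<alpha> n) m n
                       + (\<Sum>\<beta>\<in>UNIV. asym (\<lambda>m n. kron i m * \<sigma> j \<beta> * t \<beta> \<alpha> n) m n)
                       + asym (\<lambda>m n. kron i m * \<sigma> j \<alpha> * \<nu> n) m n) * \<phi> \<alpha>)
           + asym (\<lambda>m n. kron i m * \<mu> * \<sigma> j n) m n)
      + 1 / (N + 1) *
          (\<Sum>\<alpha>\<in>UNIV. asym (\<lambda>m n. kron i m * \<sigma> j n) m n
                    * (l \<alpha> + (\<Sum>\<beta>\<in>UNIV. \<sigma> \<alpha> \<beta> * \<phi> \<beta>)) * \<phi> \<alpha>)
      - 1 / (N + 1)\<^sup>2 * (l j + (\<Sum>\<alpha>\<in>UNIV. \<sigma> j \<alpha> * \<phi> \<alpha>)) *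
          (asym (\<lambda>m n. kron i m * l n) m n
           + (\<Sum>\<beta>\<in>UNIV. asym (\<lambda>m n. kron i m * \<sigma> n \<beta>) m n * \<phi> \<beta>)))"

definition weyl_W :: "'n::finite geom_object4" where
  "weyl_W L d x i j m n =
    (let N = real CARD('n); R = curv L x; Ric = ricci L x; t = torsion_part L x;
         \<sigma> = sigma d x; \<sigma>' = cov_02 L (sigma d) x; \<phi> = phi d x; \<nu> = nu d x
     in R i j m n
      + 1 / (N + 1) * kron i j * asym Ric m n
      + N / (N\<^sup>2 - 1) * asym (\<lambda>m n. kron i m * Ric j n) m n
      + 1 / (N\<^sup>2 - 1) * asym (\<lambda>m n. kron i m * Ric n j) m n
      + asym (\<lambda>m n. \<sigma>' j m n) m n * \<phi> i
      + (\<Sum>\<alpha>\<in>UNIV. asym (\<lambda>m n. \<sigma> j m * t i \<alpha> n) m n * \<phi> \<alpha>)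
      + asym (\<lambda>m n. \<sigma> j m * \<nu> n) m n * \<phi> i
      + (\<Sum>\<alpha>\<in>UNIV. asym (\<lambda>m n. \<sigma> j m * \<sigma> \<alpha> n) m n * \<phi> \<alpha> * \<phi> i)
      + 1 / (N - 1) *
          (\<Sum>\<alpha>\<in>UNIV. (asym (\<lambda>m n. kron i m * \<sigma>' j n \<alpha>) m n
                    + (\<Sum>\<beta>\<in>UNIV. asym (\<lambda>m n. kron i m * \<sigma> j n) m n * t \<beta> \<alpha> \<beta>)
                    + asym (\<lambda>m n. kron i m * \<sigma> j n) m n * \<nu> \<alpha>) * \<phi> \<alpha>)
      + 1 / (N - 1) *
          (\<Sum>\<alpha>\<in>UNIV. \<Sum>\<beta>\<in>UNIV. (asym (\<lambda>m n. kron i m * \<sigma> j n) m n * \<sigma> \<alpha> \<beta>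
                    - asym (\<lambda>m n. kron i m * \<sigma> j \<alpha> * \<sigma> n \<beta>) m n) * \<phi> \<alpha> * \<phi> \<beta>)
      - N / (N\<^sup>2 - 1) *
          (\<Sum>\<alpha>\<in>UNIV. (asym (\<lambda>m n. kron i m * \<sigma>' \<alpha> j n) m n
                    + (\<Sum>\<beta>\<in>UNIV. asym (\<lambda>m n. kron i m * \<sigma> \<beta> j * t \<beta> \<alpha> n) m n)
                    + asym (\<lambda>m n. kron i m * \<sigma> \<alpha> j * \<nu> n) m n) * \<phi> \<alpha>)
      - 1 / (N\<^sup>2 - 1) *
          (\<Sum>\<alpha>\<in>UNIV. (asym (\<lambda>m n. kron i m * \<sigma>' \<alpha> n j) m n
                    + (\<Sum>\<beta>\<in>UNIV. asym (\<lambda>m n. kron i m * \<sigma> \<beta> n) m n * t \<beta> \<alpha> j)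
                    + asym (\<lambda>m n. kron i m * \<sigma> \<alpha> n) m n * \<nu> j) * \<phi> \<alpha>))"

text \<open>
  The trace of \<open>weyl_W\<close> over \<open>i = j\<close> is \<open>N / (N + 1)\<close> times the exterior derivative of the form
  \<open>\<sigma>\<^sub>m\<^sub>\<alpha> \<phi>\<^sup>\<alpha>\<close>, whose sign changes under the mapping.  Hence \<open>weyl_W\<close> can be totally invariant only
  when this form is closed.  Adding the \<open>\<sigma>\<close>-part of the \<open>\<delta>\<^sup>i\<^sub>j\<close>-term of \<open>assoc_W\<close>, which \<open>weyl_W\<close>
  lacks, gives the trace-free object without this restriction.
\<close>

definition weyl_W_completed :: "'n::finite geom_object4" where
  "weyl_W_completed L d x i j m n =
    (let N = real CARD('n); t = torsion_part L x;
         \<sigma> = sigma d x; \<sigma>' = cov_02 L (sigma d) x; \<phi> = phi d x; \<nu> = nu d x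
     in weyl_W L d x i j m n
      - 1 / (N + 1) * kron i j *
          (\<Sum>\<alpha>\<in>UNIV. (asym (\<lambda>m n. \<sigma>' m \<alpha> n) m n
                    + (\<Sum>\<beta>\<in>UNIV. asym (\<lambda>m n. \<sigma> m \<beta> * t \<beta> \<alpha> n) m n)
                    + asym (\<lambda>m n. \<sigma> m \<alpha> * \<nu> n) m n) * \<phi> \<alpha>))"

definition sigma_phi_closed :: "(real ^ 'n::finite) set \<Rightarrow> 'n pi3_data \<Rightarrow> bool" where
  "sigma_phi_closed U d \<longleftrightarrow>
     (\<forall>x\<in>U. \<forall>m n. pd n (\<lambda>y. sigma_phi d y m) x = pd m (\<lambda>y. sigma_phi d y n) x)"

definition omega_sel ::
  "nat \<Rightarrow> 'n::finite conn \<Rightarrow> 'n pi3_data \<Rightarrow> real ^ 'n \<Rightarrow> 'n \<Rightarrow> 'n \<Rightarrow> 'n \<Rightarrow> real" where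
  "omega_sel p L d x = (if p = 1 then sym_part L x else omega L d x)"

definition torsion_terms ::
  "real \<Rightarrow> real \<Rightarrow> (nat \<Rightarrow> nat) \<Rightarrow> (nat \<Rightarrow> nat)
     \<Rightarrow> 'n::finite geom_object4" where
  "torsion_terms u u' p1 p2 L d x i j m n =
    (let t = torsion_part L x; t' = cov_12 L (torsion_part L) x; w = (\<lambda>p. omega_sel p L d x)
     in u * t' i j m n + u' * t' i j n m
      - u * ((\<Sum>\<alpha>\<in>UNIV. w (p1 1) i \<alpha> n * t \<alpha> j m)
           - (\<Sum>\<alpha>\<in>UNIV. w (p1 2) \<alpha> j n * t i \<alpha> m)
           - (\<Sum>\<alpha>\<in>UNIV. w (p1 3) \<alpha> m n * t i j \<alpha>))
      - u' * ((\<Sum>\<alpha>\<in>UNIV. w (p2 1) i \<alpha> m * t \<alpha> j n)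
            - (\<Sum>\<alpha>\<in>UNIV. w (p2 2) \<alpha> j m * t i \<alpha> n)
            - (\<Sum>\<alpha>\<in>UNIV. w (p2 3) \<alpha> m n * t i j \<alpha>)))"

definition with_torsion ::
  "'n::finite geom_object4
     \<Rightarrow> real \<Rightarrow> real \<Rightarrow> (nat \<Rightarrow> nat) \<Rightarrow> (nat \<Rightarrow> nat)
     \<Rightarrow> 'n geom_object4" where
  "with_torsion F u u' p1 p2 L d x i j m n =
     F L d x i j m n + torsion_terms u u' p1 p2 L d x i j m n"

end

theory Submission
  imports Defs
begin

text \<open>
  Write \<open>P = D / 2\<close> for the tensor \<open>P\<^sup>i\<^sub>j\<^sub>k = \<sigma>\<^sub>j\<^sub>k \<phi>\<^sup>i\<close> and let \<open>M\<close> be the symmetric connection with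
  coefficients (symmetric part of \<open>L\<close>) \<open>+ P\<close>.  For the target space the same recipe uses \<open>-D\<close> and
  gives \<open>M'\<close> = (symmetric part of \<open>L'\<close>) \<open>- P\<close>.  The first basic equation says precisely that
  \<open>M'\<^sup>i\<^sub>j\<^sub>k = M\<^sup>i\<^sub>j\<^sub>k + \<psi>\<^sub>j \<delta>\<^sup>i\<^sub>k + \<psi>\<^sub>k \<delta>\<^sup>i\<^sub>j\<close> (\<open>mean_jet_bar\<close>): \<open>M\<close> and \<open>M'\<close> are projectively related, so the
  classical projective invariants of \<open>M\<close> are unchanged by the mapping.  These invariants are the
  objects of the theorem.  The first one is the Thomas parameter \<open>T\<close> of \<open>M\<close> (\<open>thomas_T_eq\<close>), the
  basic associated one is the curvature of \<open>T\<close> (\<open>assoc_W_eq\<close>), and the completed Weyl-type object is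
  the projective Weyl tensor of \<open>M\<close> (\<open>weyl_W_completed_eq\<close>).  Derivatives of \<open>\<phi>\<close> do not occur
  in the formulas because the second basic equation turns the covariant derivative of \<open>P\<close> into an
  expression in \<open>\<sigma>\<close>, its derivatives, \<open>\<phi>\<close>, \<open>\<nu>\<close>, \<open>\<mu>\<close> and the torsion (\<open>cov_half_D\<close>).

  The torsion terms are also built from invariants: the torsion is preserved, and whenever \<open>\<omega>\<close>
  replaces the connection in a covariant derivative of the torsion, the difference
  of the two is \<open>T\<close> (\<open>torsion_terms_eq\<close>).

  The second basic equation is inherited by the inverse mapping, with \<open>-\<psi>\<close>, \<open>-\<sigma>\<close>, the same \<open>\<phi>\<close>, and
  suitably changed \<open>\<nu>\<close> and \<open>\<mu>\<close> (\<open>corresponding_inverse_data\<close>).  An equitorsion mapping therefore always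
  has the property of reciprocity.  Both sides of the equivalences about total invariance then hold,
  except for the Weyl-type object without completion.  It differs from the invariant one by a multiple
  of \<open>\<delta>\<^sup>i\<^sub>j\<close> times the exterior derivative of \<open>\<sigma>\<^sub>m\<^sub>\<alpha> \<phi>\<^sup>\<alpha>\<close>.  This form is a trace of \<open>P\<close> and changes sign with
  \<open>D\<close>; the value is recovered from \<open>-D\<close> after a change of sign in the formula, and the form is preserved
  only if the exterior derivative vanishes (\<open>curl_defect_valued\<close>, \<open>curl_defect_total\<close>).

  All objects depend only on first derivatives, so the algebra is done at one point, on 1-jets: pairs
  consisting of the values and the first partial derivatives of an array with three indices.
\<close>

section \<open>Partial derivatives and smooth functions\<close>

lemma pd_has_derivative: "(f has_derivative f') (at x) \<Longrightarrow> pd n f x = f' (axis n 1)"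
  by (simp add: pd_def frechet_derivative_at[symmetric])

lemma pd_const: "pd n (\<lambda>x. c) x = 0"
  by (simp add: pd_def)

lemma pd_add:
  assumes "f differentiable at x" "g differentiable at x"
  shows "pd n (\<lambda>x. f x + g x) x = pd n f x + pd n g x"
  using pd_has_derivative[OF has_derivative_add[OF assms[unfolded frechet_derivative_works]], of n]
  by (simp add: pd_def)

lemma pd_diff:
  assumes "f differentiable at x" "g differentiable at x"
  shows "pd n (\<lambda>x. f x - g x) x = pd n f x - pd n g x"
  using pd_has_derivative[OF has_derivative_diff[OF assms[unfolded frechet_derivative_works]], of n]
  by (simp add: pd_def)

lemma pd_mult:
  assumes "f differentiable at x" "g differentiable at x"
  shows "pd n (\<lambda>x. f x * g x) x = f x * pd n g x + pd n f x * g x"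
  using pd_has_derivative[OF has_derivative_mult[OF assms[unfolded frechet_derivative_works]], of n]
  by (simp add: pd_def)

lemma pd_cmult: "f differentiable at x \<Longrightarrow> pd n (\<lambda>x. c * f x) x = c * pd n f x"
  by (simp add: pd_mult pd_const)

lemma pd_half_sum_diff:
  fixes f g :: "real ^ 'n::finite \<Rightarrow> real"
  assumes "f differentiable at x" "g differentiable at x"
  shows "pd n (\<lambda>x. (f x + g x) / 2) x = (pd n f x + pd n g x) / 2"
    and "pd n (\<lambda>x. (f x - g x) / 2) x = (pd n f x - pd n g x) / 2"
proof -
  have half: "(\<lambda>x. h x / 2) = (\<lambda>x. 1 / 2 * h x)" for h :: "real ^ 'n \<Rightarrow> real" by simp
  have "(\<lambda>x. f x + g x) differentiable at x" "(\<lambda>x. f x - g x) differentiable at x"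
    using assms by (rule differentiable_add differentiable_diff)+
  note pd_cmult[OF this(1), of n "1 / 2"] pd_cmult[OF this(2), of n "1 / 2"]
  then show "pd n (\<lambda>x. (f x + g x) / 2) x = (pd n f x + pd n g x) / 2"
    and "pd n (\<lambda>x. (f x - g x) / 2) x = (pd n f x - pd n g x) / 2"
    unfolding half pd_add[OF assms] pd_diff[OF assms] by (simp_all only: mult_1 times_divide_eq_left)
qed

lemma pd_sum:
  assumes "\<And>a. a \<in> A \<Longrightarrow> f a differentiable at x"
  shows "pd n (\<lambda>x. \<Sum>a\<in>A. f a x) x = (\<Sum>a\<in>A. pd n (f a) x)"
  using pd_has_derivative[OF has_derivative_sum[of A f "\<lambda>a. frechet_derivative (f a) (at x)" "at x"], of n] assms
  by (simp add: pd_def frechet_derivative_works[symmetric])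

text \<open>
  This holds for all functions, differentiable or not, because \<open>frechet_derivative\<close> chooses among the
  derivatives at the point, and these are determined by the germ.
\<close>

lemma pd_cong:
  assumes "open U" "x \<in> U" "\<And>y. y \<in> U \<Longrightarrow> f y = g y"
  shows "pd n f x = pd n g x"
proof -
  have "(f has_derivative f') (at x) \<longleftrightarrow> (g has_derivative f') (at x)" for f'
    using has_derivative_transform_within_open[OF _ assms(1,2)] assms(3) by metis
  then show ?thesis
    by (simp add: pd_def frechet_derivative_def)
qed

lemma Ck_on_cong:
  assumes "open U" "\<And>x. x \<in> U \<Longrightarrow> f x = g x" "Ck_on k U f"
  shows "Ck_on k U g"
  using assms(2,3)
proof (induction k arbitrary: f g)
  case 0
  then show ?case using continuous_on_cong[of U U f g] by simp
next
  case (Suc k)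
  have "g differentiable_on U"
    using Suc.prems differentiable_transform_within[of f _ U 1 g]
    by (auto simp: differentiable_on_def)
  moreover have "Ck_on k U (pd n g)" for n
    using Suc.IH[of "pd n f" "pd n g"] pd_cong[OF \<open>open U\<close>, of _ f g n] Suc.prems by simp
  ultimately show ?case by simp
qed

lemma Ck_on_mono_Suc: "Ck_on (Suc k) U f \<Longrightarrow> Ck_on k U f"
  by (induction k arbitrary: f) (auto intro: differentiable_imp_continuous_on)

lemma Ck_on_const: "Ck_on k U (\<lambda>x. c)"
  by (induction k arbitrary: c) (simp_all add: pd_const[abs_def])

lemma Ck_on_add:
  assumes "open U" "Ck_on k U f" "Ck_on k U g"
  shows "Ck_on k U (\<lambda>x. f x + g x)"
  using assms(2,3)
proof (induction k arbitrary: f g)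
  case 0
  then show ?case by (simp add: continuous_on_add)
next
  case (Suc k)
  have "Ck_on k U (pd n (\<lambda>x. f x + g x))" for n
    by (rule Ck_on_cong[OF \<open>open U\<close> _ Suc.IH[of "pd n f" "pd n g"]])
      (use Suc.prems in \<open>auto simp: pd_add differentiable_on_eq_differentiable_at[OF \<open>open U\<close>]\<close>)
  then show ?case using Suc.prems by (simp add: differentiable_on_add)
qed

lemma Ck_on_mult:
  assumes "open U" "Ck_on k U f" "Ck_on k U g"
  shows "Ck_on k U (\<lambda>x. f x * g x)"
  using assms(2,3)
proof (induction k arbitrary: f g)
  case 0
  then show ?case by (simp add: continuous_on_mult)
next
  case (Suc k)
  have "Ck_on k U (pd n (\<lambda>x. f x * g x))" for n
    by (rule Ck_on_cong[OF \<open>open U\<close> _ Ck_on_add[OF \<open>open U\<close> Suc.IH[of f "pd n g"] Suc.IH[of "pd n f" g]]])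
      (use Suc.prems Ck_on_mono_Suc[OF Suc.prems(1)] Ck_on_mono_Suc[OF Suc.prems(2)] in
        \<open>auto simp: pd_mult differentiable_on_eq_differentiable_at[OF \<open>open U\<close>]\<close>)
  then show ?case using Suc.prems by (simp add: differentiable_on_mult)
qed

lemma smooth_on_add: "open U \<Longrightarrow> smooth_on U f \<Longrightarrow> smooth_on U g \<Longrightarrow> smooth_on U (\<lambda>x. f x + g x)"
  by (simp add: smooth_on_def Ck_on_add)

lemma smooth_on_mult: "open U \<Longrightarrow> smooth_on U f \<Longrightarrow> smooth_on U g \<Longrightarrow> smooth_on U (\<lambda>x. f x * g x)"
  by (simp add: smooth_on_def Ck_on_mult)

lemma smooth_on_const: "smooth_on U (\<lambda>x. c)"
  by (simp add: smooth_on_def Ck_on_const)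

lemma smooth_on_minus: "open U \<Longrightarrow> smooth_on U f \<Longrightarrow> smooth_on U (\<lambda>x. - f x)"
  using smooth_on_mult[OF _ smooth_on_const, of U f "-1"] by simp

lemma smooth_on_sum:
  assumes "open U" "\<And>a. a \<in> A \<Longrightarrow> smooth_on U (f a)"
  shows "smooth_on U (\<lambda>x. \<Sum>a\<in>A. f a x)"
  using assms(2)
  by (induction A rule: infinite_finite_induct) (simp_all add: smooth_on_const smooth_on_add[OF assms(1)])

lemma smooth_on_differentiable:
  assumes "smooth_on U f" "open U" "x \<in> U"
  shows "f differentiable at x"
  using assms differentiable_on_eq_differentiable_at unfolding smooth_on_def
  by (metis Ck_on.simps(2))


section \<open>Algebra of one-jets\<close>

lemma sum_kron [simp]:
  fixes f :: "'n::finite \<Rightarrow> real"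
  shows "(\<Sum>a\<in>UNIV. kron a j * f a) = f j" "(\<Sum>a\<in>UNIV. kron j a * f a) = f j"
    "(\<Sum>a\<in>UNIV. f a * kron a j) = f j" "(\<Sum>a\<in>UNIV. f a * kron j a) = f j"
    and kron_self [simp]: "kron a a = 1"
  by (simp_all add: kron_def if_distrib[of "\<lambda>x. x * _"] if_distrib[of "\<lambda>x. _ * x"] cong: if_cong)

type_synonym 'n jet = "('n \<Rightarrow> 'n \<Rightarrow> 'n \<Rightarrow> real) \<times> ('n \<Rightarrow> 'n \<Rightarrow> 'n \<Rightarrow> 'n \<Rightarrow> real)"

text \<open>
  The second component of a jet has the index of differentiation last.
\<close>

definition curv_jet :: "'n::finite jet \<Rightarrow> 'n \<Rightarrow> 'n \<Rightarrow> 'n \<Rightarrow> 'n \<Rightarrow> real" where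
  "curv_jet J i j m n = snd J i j m n - snd J i j n m
     + (\<Sum>\<alpha>\<in>UNIV. fst J \<alpha> j m * fst J i \<alpha> n) - (\<Sum>\<alpha>\<in>UNIV. fst J \<alpha> j n * fst J i \<alpha> m)"

definition ricci_jet :: "'n::finite jet \<Rightarrow> 'n \<Rightarrow> 'n \<Rightarrow> real" where
  "ricci_jet J i j = (\<Sum>\<alpha>\<in>UNIV. curv_jet J \<alpha> i j \<alpha>)"

definition weyl_jet :: "'n::finite jet \<Rightarrow> 'n \<Rightarrow> 'n \<Rightarrow> 'n \<Rightarrow> 'n \<Rightarrow> real" where
  "weyl_jet J i j m n = (let N = real CARD('n); R = ricci_jet J in
     curv_jet J i j m n + 1 / (N + 1) * kron i j * (R m n - R n m)
     + N / (N\<^sup>2 - 1) * (kron i m * R j n - kron i n * R j m)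
     + 1 / (N\<^sup>2 - 1) * (kron i m * R n j - kron i n * R m j))"

text \<open>
  The projective change by a covector field, which also enters through its 1-jet.
\<close>

definition proj_change ::
  "('n \<Rightarrow> real) \<times> ('n \<Rightarrow> 'n \<Rightarrow> real) \<Rightarrow> 'n::finite jet \<Rightarrow> 'n jet" where
  "proj_change p J =
     (\<lambda>i j k. fst J i j k + fst p j * kron i k + fst p k * kron i j,
      \<lambda>i j k n. snd J i j k n + snd p j n * kron i k + snd p k n * kron i j)"

definition trace_jet :: "'n::finite jet \<Rightarrow> ('n \<Rightarrow> real) \<times> ('n \<Rightarrow> 'n \<Rightarrow> real)" where
  "trace_jet J = (\<lambda>j. \<Sum>\<alpha>\<in>UNIV. fst J \<alpha> j \<alpha>, \<lambda>j n. \<Sum>\<alpha>\<in>UNIV. snd J \<alpha> j \<alpha> n)"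

text \<open>
  The trace of \<open>\<psi>\<^sub>j \<delta>\<^sup>i\<^sub>k + \<psi>\<^sub>k \<delta>\<^sup>i\<^sub>j\<close> is \<open>(N + 1) \<psi>\<^sub>j\<close>, so the Thomas parameter is the representative of the
  projective class with vanishing trace.
\<close>

definition thomas_jet :: "'n::finite jet \<Rightarrow> 'n jet" where
  "thomas_jet J = proj_change
     (\<lambda>j. - fst (trace_jet J) j / (real CARD('n) + 1), \<lambda>j n. - snd (trace_jet J) j n / (real CARD('n) + 1)) J"

text \<open>
  \<open>\<psi>\<^sub>j\<^sub>;\<^sub>n - \<psi>\<^sub>j \<psi>\<^sub>n\<close>, the only combination through which a projective change acts on the curvature.
\<close>

definition proj_schouten ::
  "('n \<Rightarrow> real) \<times> ('n \<Rightarrow> 'n \<Rightarrow> real) \<Rightarrow> 'n::finite jet \<Rightarrow> 'n \<Rightarrow> 'n \<Rightarrow> real" where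
  "proj_schouten p J j n = snd p j n - (\<Sum>\<alpha>\<in>UNIV. fst J \<alpha> j n * fst p \<alpha>) - fst p j * fst p n"

text \<open>
  The classical formula.  Among the terms quadratic in connection and covector, those with a free upper
  index of the connection cancel by symmetry in \<open>m\<close>, \<open>n\<close>; the others complete the partial derivatives of
  the covector to covariant ones.
\<close>

lemma curv_jet_proj_change:
  fixes J :: "'n::finite jet" and p
  assumes sym: "\<And>i j k. fst J i j k = fst J i k j"
  defines "B \<equiv> proj_schouten p J"
  shows "curv_jet (proj_change p J) i j m n = curv_jet J i j m n
     + kron i j * (B m n - B n m) + kron i m * B j n - kron i n * B j m"
proof -
  define G where "G = fst J"
  define q where "q = fst p"
  have prod: "(\<Sum>\<alpha>\<in>UNIV. (G \<alpha> j m + q j * kron \<alpha> m + q m * kron \<alpha> j) * (G i \<alpha> n + q \<alpha> * kron i n + q n * kron i \<alpha>))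
    = (\<Sum>\<alpha>\<in>UNIV. G \<alpha> j m * G i \<alpha> n) + kron i n * (\<Sum>\<alpha>\<in>UNIV. G \<alpha> j m * q \<alpha>) + q n * G i j m
      + q j * (G i m n + q m * kron i n + q n * kron i m) + q m * (G i j n + q j * kron i n + q n * kron i j)" for m n
  proof -
    have "(\<Sum>\<alpha>\<in>UNIV. (G \<alpha> j m + q j * kron \<alpha> m + q m * kron \<alpha> j) * (G i \<alpha> n + q \<alpha> * kron i n + q n * kron i \<alpha>))
      = (\<Sum>\<alpha>\<in>UNIV. G \<alpha> j m * G i \<alpha> n + kron i n * (G \<alpha> j m * q \<alpha>) + q n * (G \<alpha> j m * kron i \<alpha>)
        + q j * (kron \<alpha> m * (G i \<alpha> n + q \<alpha> * kron i n + q n * kron i \<alpha>))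
        + q m * (kron \<alpha> j * (G i \<alpha> n + q \<alpha> * kron i n + q n * kron i \<alpha>)))"
      by (simp add: algebra_simps)
    then show ?thesis
      by (simp only: sum.distrib sum_distrib_left[symmetric] sum_kron)
  qed
  have s: "G i m n = G i n m" for i m n using sym by (simp add: G_def)
  show ?thesis
    unfolding curv_jet_def B_def proj_schouten_def proj_change_def fst_conv snd_conv
      G_def[symmetric] q_def[symmetric] prod
    by (simp add: s[of i n m] s[of _ n m] algebra_simps)
qed

lemma ricci_jet_proj_change:
  fixes J :: "'n::finite jet" and p
  assumes sym: "\<And>i j k. fst J i j k = fst J i k j"
  defines "B \<equiv> proj_schouten p J"
  shows "ricci_jet (proj_change p J) j n = ricci_jet J j n + B n j - real CARD('n) * B j n"
  unfolding ricci_jet_def curv_jet_proj_change[of J p, OF sym] B_def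
  by (simp add: sum.distrib sum_subtractf right_diff_distrib)

text \<open>
  The Ricci tensor changes by \<open>B\<^sub>n\<^sub>j - N B\<^sub>j\<^sub>n\<close>, where \<open>B\<close> is \<open>proj_schouten\<close>.  For \<open>N > 1\<close> this can be solved
  for \<open>B\<close>, and the coefficients of the Weyl tensor are those that remove \<open>B\<close> from the curvature.
\<close>

lemma weyl_jet_proj_change:
  fixes J :: "'n::finite jet"
  assumes sym: "\<And>i j k. fst J i j k = fst J i k j" and N: "1 < CARD('n)"
  shows "weyl_jet (proj_change p J) i j m n = weyl_jet J i j m n"
proof -
  define N where "N = real CARD('n)"
  define B where "B = proj_schouten p J"
  define R where "R = ricci_jet J"
  define C where "C = curv_jet J i j m n"
  define a b c where "a = 1 / (N + 1)" and "b = N / (N\<^sup>2 - 1)" and "c = 1 / (N\<^sup>2 - 1)"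
  have nz: "N - 1 \<noteq> 0" "N + 1 \<noteq> 0" using N by (auto simp: N_def)
  have N2: "N\<^sup>2 - 1 = (N - 1) * (N + 1)" by (simp add: power2_eq_square algebra_simps)
  \<comment> \<open>The parts multiplying \<open>kron i j\<close> and \<open>kron i m\<close> vanish separately.\<close>
  have "kron i j * (B m n - B n m) + a * kron i j * ((B n m - N * B m n) - (B m n - N * B n m)) = 0"
    unfolding a_def using nz by (simp add: field_simps)
  moreover have "kron i m * B j n + b * (kron i m * (B n j - N * B j n))
      + c * (kron i m * (B j n - N * B n j)) = 0" for m n
    unfolding b_def c_def N2 using nz by (simp add: divide_simps) (simp add: algebra_simps)
  note this[of m n] this[of n m]
  ultimately show ?thesis
    unfolding weyl_jet_def Let_def curv_jet_proj_change[of J p, OF sym]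
      ricci_jet_proj_change[of J p, OF sym] N_def[symmetric] B_def[symmetric] R_def[symmetric] C_def[symmetric]
      a_def[symmetric] b_def[symmetric] c_def[symmetric]
    by (simp add: algebra_simps)
qed

lemma trace_jet_proj_change:
  fixes J :: "'n::finite jet"
  shows "trace_jet (proj_change p J) =
    (\<lambda>j. fst (trace_jet J) j + (real CARD('n) + 1) * fst p j,
     \<lambda>j n. snd (trace_jet J) j n + (real CARD('n) + 1) * snd p j n)"
  by (simp add: trace_jet_def proj_change_def sum.distrib algebra_simps)

lemma thomas_jet_proj_change:
  fixes J :: "'n::finite jet"
  shows "thomas_jet (proj_change p J) = thomas_jet J"
proof -
  have div: "- (t + (real CARD('n) + 1) * q) / (real CARD('n) + 1) = - t / (real CARD('n) + 1) - q" for t q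
    by (simp add: field_simps add_nonneg_eq_0_iff)
  show ?thesis
    unfolding thomas_jet_def trace_jet_proj_change fst_conv snd_conv div
    by (simp add: proj_change_def fun_eq_iff left_diff_distrib)
qed

section \<open>Covariant derivatives and curvature of a deformed connection\<close>

definition cov_jet :: "'n::finite jet \<Rightarrow> 'n jet \<Rightarrow> 'n \<Rightarrow> 'n \<Rightarrow> 'n \<Rightarrow> 'n \<Rightarrow> real" where
  "cov_jet J P i j m n = snd P i j m n
     + (\<Sum>\<alpha>\<in>UNIV. fst J i \<alpha> n * fst P \<alpha> j m)
     - (\<Sum>\<alpha>\<in>UNIV. fst J \<alpha> j n * fst P i \<alpha> m)
     - (\<Sum>\<alpha>\<in>UNIV. fst J \<alpha> m n * fst P i j \<alpha>)"

definition sum_jet :: "'n jet \<Rightarrow> 'n jet \<Rightarrow> 'n jet" where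
  "sum_jet J P = (\<lambda>i j k. fst J i j k + fst P i j k, \<lambda>i j k n. snd J i j k n + snd P i j k n)"

text \<open>
  Adding a tensor to a symmetric connection changes the curvature by the antisymmetrized covariant
  derivative of the tensor and a quadratic term.
\<close>

lemma curv_jet_sum_jet:
  assumes sym: "\<And>i j k. fst J i j k = fst J i k j"
  shows "curv_jet (sum_jet J P) i j m n = curv_jet J i j m n + cov_jet J P i j m n - cov_jet J P i j n m
    + (\<Sum>\<alpha>\<in>UNIV. fst P \<alpha> j m * fst P i \<alpha> n) - (\<Sum>\<alpha>\<in>UNIV. fst P \<alpha> j n * fst P i \<alpha> m)"
proof -
  have "(\<Sum>\<alpha>\<in>UNIV. fst J \<alpha> m n * fst P i j \<alpha>) = (\<Sum>\<alpha>\<in>UNIV. fst J \<alpha> n m * fst P i j \<alpha>)"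
    by (simp only: sym[of _ m n])
  then show ?thesis
    unfolding curv_jet_def cov_jet_def sum_jet_def fst_conv snd_conv
    by (simp add: distrib_left distrib_right sum.distrib mult.commute)
qed

text \<open>
  Covariant differentiation commutes with contraction.  Since only the algebraic form of the derivative
  matters, this applies to connection coefficients as well as to tensors.
\<close>

lemma cov_jet_trace:
  "(\<Sum>\<alpha>\<in>UNIV. cov_jet J P \<alpha> j \<alpha> n)
     = snd (trace_jet P) j n - (\<Sum>\<beta>\<in>UNIV. fst J \<beta> j n * fst (trace_jet P) \<beta>)"
proof -
  have "(\<Sum>\<alpha>\<in>UNIV. \<Sum>\<beta>\<in>UNIV. fst J \<alpha> \<beta> n * fst P \<beta> j \<alpha>) = (\<Sum>\<alpha>\<in>UNIV. \<Sum>\<beta>\<in>UNIV. fst J \<beta> \<alpha> n * fst P \<alpha> j \<beta>)"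
    by (rule sum.swap)
  moreover have "(\<Sum>\<alpha>\<in>UNIV. \<Sum>\<beta>\<in>UNIV. fst J \<beta> j n * fst P \<alpha> \<beta> \<alpha>)
      = (\<Sum>\<beta>\<in>UNIV. \<Sum>\<alpha>\<in>UNIV. fst J \<beta> j n * fst P \<alpha> \<beta> \<alpha>)"
    by (rule sum.swap)
  ultimately show ?thesis
    unfolding cov_jet_def trace_jet_def fst_conv snd_conv
    by (simp add: sum.distrib sum_subtractf sum_distrib_left)
qed

text \<open>
  The first Bianchi identity in contracted form: the antisymmetric part of the Ricci tensor is the
  exterior derivative of the contracted connection.
\<close>

lemma ricci_jet_antisym:
  assumes sym: "\<And>i j k. fst J i j k = fst J i k j" "\<And>i j k n. snd J i j k n = snd J i k j n"
  shows "ricci_jet J m n - ricci_jet J n m = snd (trace_jet J) n m - snd (trace_jet J) m n"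
proof -
  have "fst J \<beta> m \<alpha> * fst J \<alpha> \<beta> n = fst J \<alpha> n \<beta> * fst J \<beta> \<alpha> m" for \<alpha> \<beta>
    using sym(1)[of \<beta> m \<alpha>] sym(1)[of \<alpha> n \<beta>] by simp
  then have "(\<Sum>\<alpha>\<in>UNIV. \<Sum>\<beta>\<in>UNIV. fst J \<beta> m \<alpha> * fst J \<alpha> \<beta> n) = (\<Sum>\<alpha>\<in>UNIV. \<Sum>\<beta>\<in>UNIV. fst J \<beta> n \<alpha> * fst J \<alpha> \<beta> m)"
    by (subst sum.swap) simp
  moreover have "(\<Sum>\<alpha>\<in>UNIV. \<Sum>\<beta>\<in>UNIV. fst J \<beta> m n * fst J \<alpha> \<beta> \<alpha>) = (\<Sum>\<alpha>\<in>UNIV. \<Sum>\<beta>\<in>UNIV. fst J \<beta> n m * fst J \<alpha> \<beta> \<alpha>)"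
    "(\<Sum>\<alpha>\<in>UNIV. snd J \<alpha> m n \<alpha>) = (\<Sum>\<alpha>\<in>UNIV. snd J \<alpha> n m \<alpha>)"
    by (simp_all only: sym(1)[of _ m n] sym(2)[of _ m n])
  ultimately show ?thesis
    unfolding ricci_jet_def curv_jet_def trace_jet_def snd_conv
    by (simp add: sum.distrib sum_subtractf)
qed

section \<open>Jets of the connection and of the deformation tensor\<close>

lemma curv_eq_curv_jet: "curv L x = curv_jet (jet1 (sym_part L) x)"
  by (simp add: fun_eq_iff curv_def curv_jet_def jet1_def)

lemma ricci_eq_ricci_jet: "ricci L x = ricci_jet (jet1 (sym_part L) x)"
  by (simp add: fun_eq_iff ricci_def ricci_jet_def curv_eq_curv_jet)

lemma cov_12_eq_cov_jet: "cov_12 L A x = cov_jet (jet1 (sym_part L) x) (jet1 A x)"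
  by (simp add: fun_eq_iff cov_12_def cov_jet_def jet1_def)

lemma sym_part_commute: "sym_part L x i j k = sym_part L x i k j"
  by (simp add: sym_part_def add.commute)

lemma jet1_sym_part_commute:
  "fst (jet1 (sym_part L) x) i j k = fst (jet1 (sym_part L) x) i k j"
  "snd (jet1 (sym_part L) x) i j k n = snd (jet1 (sym_part L) x) i k j n"
  by (simp_all add: jet1_def sym_part_commute[of L _ i j k])

definition half_jet :: "'n jet \<Rightarrow> 'n jet" where
  "half_jet K = (\<lambda>i j k. fst K i j k / 2, \<lambda>i j k n. snd K i j k n / 2)"

definition sym_jet :: "'n jet \<Rightarrow> 'n jet" where
  "sym_jet J = (\<lambda>i j k. (fst J i j k + fst J i k j) / 2, \<lambda>i j k n. (snd J i j k n + snd J i k j n) / 2)"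

definition tors_jet :: "'n jet \<Rightarrow> 'n jet" where
  "tors_jet J = (\<lambda>i j k. (fst J i j k - fst J i k j) / 2, \<lambda>i j k n. (snd J i j k n - snd J i k j n) / 2)"

text \<open>
  The tensor \<open>P = D / 2\<close>.
\<close>

definition half_D :: "'n::finite pi3_data \<Rightarrow> 'n conn" where
  "half_D d x i j k = sigma d x j k * phi d x i"

lemma jet1_cong:
  assumes "open U" "x \<in> U" "\<And>y i j k. y \<in> U \<Longrightarrow> A y i j k = B y i j k"
  shows "jet1 A x = jet1 B x"
proof -
  have "pd n (\<lambda>y. A y i j k) x = pd n (\<lambda>y. B y i j k) x" for i j k n
    by (rule pd_cong[OF assms])
  then show ?thesis by (simp add: jet1_def fun_eq_iff assms(2,3))
qed

lemma jet1_parts: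
  assumes "\<And>i j k. (\<lambda>y. L y i j k) differentiable at x"
  shows jet1_sym_part: "jet1 (sym_part L) x = sym_jet (jet1 L x)"
    and jet1_torsion_part: "jet1 (torsion_part L) x = tors_jet (jet1 L x)"
proof -
  show "jet1 (sym_part L) x = sym_jet (jet1 L x)"
    unfolding jet1_def sym_jet_def sym_part_def pd_half_sum_diff(1)[OF assms assms] by (simp add: fun_eq_iff sym_part_def)
  show "jet1 (torsion_part L) x = tors_jet (jet1 L x)"
    unfolding jet1_def tors_jet_def torsion_part_def pd_half_sum_diff(2)[OF assms assms] by (simp add: fun_eq_iff torsion_part_def)
qed

text \<open>
  The covariant derivative of \<open>\<sigma>\<^sub>j\<^sub>\<alpha> \<phi>\<^sup>\<alpha>\<close> and the divergence \<open>P\<^sup>\<alpha>\<^sub>j\<^sub>n\<^sub>|\<^sub>\<alpha>\<close>, both after elimination of the derivatives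
  of \<open>\<phi>\<close> and without the multiple of \<open>\<mu> \<sigma>\<^sub>j\<^sub>n\<close>; see \<open>cov_half_D_trace\<close> and \<open>cov_half_D_divergence\<close>.
\<close>

definition cov_trace :: "'n::finite conn \<Rightarrow> 'n pi3_data \<Rightarrow> real ^ 'n \<Rightarrow> 'n \<Rightarrow> 'n \<Rightarrow> real" where
  "cov_trace L d x j n = (\<Sum>\<alpha>\<in>UNIV. (cov_02 L (sigma d) x j \<alpha> n
     + (\<Sum>\<beta>\<in>UNIV. sigma d x j \<beta> * torsion_part L x \<beta> \<alpha> n) + sigma d x j \<alpha> * nu d x n) * phi d x \<alpha>)"

definition cov_div :: "'n::finite conn \<Rightarrow> 'n pi3_data \<Rightarrow> real ^ 'n \<Rightarrow> 'n \<Rightarrow> 'n \<Rightarrow> real" where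
  "cov_div L d x j n = (\<Sum>\<alpha>\<in>UNIV. (cov_02 L (sigma d) x j n \<alpha>
     + (\<Sum>\<beta>\<in>UNIV. sigma d x j n * torsion_part L x \<beta> \<alpha> \<beta>) + sigma d x j n * nu d x \<alpha>) * phi d x \<alpha>)"

text \<open>
  The jet of \<open>M\<close>, obtained from the jets of the full connection and of \<open>D\<close>.
\<close>

definition mean_jet :: "'n jet \<Rightarrow> 'n jet \<Rightarrow> 'n jet" where
  "mean_jet J K = sum_jet (sym_jet J) (half_jet K)"

text \<open>
  The connection \<open>M\<close> is, up to a projective change, the mean of the symmetric parts of \<open>L\<close> and \<open>L'\<close>.
\<close>

definition mean_conn :: "'n::finite conn \<Rightarrow> 'n pi3_data \<Rightarrow> real ^ 'n \<Rightarrow> 'n jet" where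
  "mean_conn L d x = sum_jet (jet1 (sym_part L) x) (jet1 (half_D d) x)"

lemma fst_mean_conn: "fst (mean_conn L d x) i j k = sym_part L x i j k + half_D d x i j k"
  by (simp add: mean_conn_def sum_jet_def jet1_def)

lemma trace_mean_conn: "fst (trace_jet (mean_conn L d x)) j = contr_sym L x j + sigma_phi d x j"
  by (simp add: trace_jet_def fst_mean_conn half_D_def contr_sym_def sigma_phi_def sum.distrib)

lemmas expand_sums = algebra_simps sum.distrib sum_subtractf sum_distrib_left sum_distrib_right sum_negf

context
  fixes U :: "(real ^ 'n::finite) set" and L L' :: "'n conn" and d :: "'n pi3_data" and x :: "real ^ 'n"
  assumes map: "pi3_mapping U L L' d" and x: "x \<in> U"
begin

lemma pi3_card: "1 < CARD('n)" and pi3_open: "open U"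
  using map by (auto simp: pi3_mapping_def GA_space_def)

lemma pi3_differentiable: "(\<lambda>y. L y i j k) differentiable at x" "(\<lambda>y. L' y i j k) differentiable at x"
  "(\<lambda>y. psi d y j) differentiable at x" "(\<lambda>y. sigma d y j k) differentiable at x"
  "(\<lambda>y. phi d y i) differentiable at x"
  using map by (auto simp: pi3_mapping_def GA_space_def smooth_data_def
      intro!: smooth_on_differentiable[OF _ pi3_open x])

lemma sigma_commute: "sigma d x j k = sigma d x k j"
  using map x by (simp add: pi3_mapping_def)

lemma pd_sigma_commute: "pd n (\<lambda>y. sigma d y j k) x = pd n (\<lambda>y. sigma d y k j) x"
  using map by (intro pd_cong[OF pi3_open x]) (simp add: pi3_mapping_def)

lemma cov_sigma_commute: "cov_02 L (sigma d) x j k n = cov_02 L (sigma d) x k j n"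
  unfolding cov_02_def pd_sigma_commute[of n j k]
  by (simp only: sigma_commute[of _ k] sigma_commute[of j])

lemma pd_half_D: "pd n (\<lambda>y. half_D d y i j m) x
   = sigma d x j m * pd n (\<lambda>y. phi d y i) x + pd n (\<lambda>y. sigma d y j m) x * phi d x i"
  by (simp add: half_D_def pd_mult pi3_differentiable)

lemma half_jet_D: "half_jet (jet1 (D_tensor d) x) = jet1 (half_D d) x"
  by (simp add: half_jet_def jet1_def D_tensor_def half_D_def pd_mult pd_const pi3_differentiable mult.assoc fun_eq_iff distrib_left)

text \<open>
  The second basic equation determines \<open>\<phi>\<^sup>i\<^sub>,\<^sub>n\<close>.  It uses the full connection, whereas the covariant
  derivative here uses the symmetric part: hence the torsion term.
\<close>

lemma cov_half_D:
  "cov_12 L (half_D d) x i j m n = cov_02 L (sigma d) x j m n * phi d x i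
     + sigma d x j m * (nu d x n * phi d x i + mu d x * kron i n + (\<Sum>\<alpha>\<in>UNIV. torsion_part L x i \<alpha> n * phi d x \<alpha>))"
proof -
  have "(\<Sum>\<alpha>\<in>UNIV. L x i n \<alpha> * phi d x \<alpha>)
     = (\<Sum>\<alpha>\<in>UNIV. sym_part L x i \<alpha> n * phi d x \<alpha>) - (\<Sum>\<alpha>\<in>UNIV. torsion_part L x i \<alpha> n * phi d x \<alpha>)"
    by (simp add: sum_subtractf[symmetric] sym_part_def torsion_part_def field_simps)
  moreover have "pd n (\<lambda>y. phi d y i) x + (\<Sum>\<alpha>\<in>UNIV. L x i n \<alpha> * phi d x \<alpha>) = nu d x n * phi d x i + mu d x * kron i n"
    using map x by (simp add: pi3_mapping_def cov2_vec_def)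
  ultimately have phi: "pd n (\<lambda>y. phi d y i) x = nu d x n * phi d x i + mu d x * kron i n
     + (\<Sum>\<alpha>\<in>UNIV. torsion_part L x i \<alpha> n * phi d x \<alpha>) - (\<Sum>\<alpha>\<in>UNIV. sym_part L x i \<alpha> n * phi d x \<alpha>)"
    by simp
  have s1: "(\<Sum>\<alpha>\<in>UNIV. sym_part L x i \<alpha> n * (sigma d x j m * phi d x \<alpha>))
    = sigma d x j m * (\<Sum>\<alpha>\<in>UNIV. sym_part L x i \<alpha> n * phi d x \<alpha>)"
    by (simp add: sum_distrib_left ac_simps)
  have s2: "(\<Sum>\<alpha>\<in>UNIV. a \<alpha> * (b \<alpha> * phi d x i)) = (\<Sum>\<alpha>\<in>UNIV. a \<alpha> * b \<alpha>) * phi d x i" for a b :: "'n \<Rightarrow> real"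
    by (simp add: sum_distrib_right mult.assoc)
  show ?thesis
    unfolding cov_12_def cov_02_def pd_half_D phi unfolding half_D_def s1 s2
    by (simp add: algebra_simps)
qed

lemma trace_half_D:
  "fst (trace_jet (jet1 (half_D d) x)) j = sigma_phi d x j"
  "snd (trace_jet (jet1 (half_D d) x)) j n = pd n (\<lambda>y. sigma_phi d y j) x"
proof -
  have "(\<lambda>y. sigma_phi d y j) = (\<lambda>y. \<Sum>\<alpha>\<in>UNIV. half_D d y \<alpha> j \<alpha>)"
    by (simp add: sigma_phi_def half_D_def fun_eq_iff)
  moreover have "(\<lambda>y. half_D d y i j k) differentiable at x" for i j k
    by (simp add: half_D_def pi3_differentiable)
  ultimately show "snd (trace_jet (jet1 (half_D d) x)) j n = pd n (\<lambda>y. sigma_phi d y j) x"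
    by (simp add: trace_jet_def jet1_def pd_sum)
qed (simp add: trace_jet_def jet1_def sigma_phi_def half_D_def)

lemma cov_half_D_trace:
  "(\<Sum>\<alpha>\<in>UNIV. cov_12 L (half_D d) x \<alpha> j \<alpha> n) = cov_trace L d x j n + mu d x * sigma d x j n"
proof -
  have "(\<Sum>\<alpha>\<in>UNIV. \<Sum>\<beta>\<in>UNIV. sigma d x j \<alpha> * (torsion_part L x \<alpha> \<beta> n * phi d x \<beta>))
    = (\<Sum>\<alpha>\<in>UNIV. \<Sum>\<beta>\<in>UNIV. sigma d x j \<beta> * (torsion_part L x \<beta> \<alpha> n * phi d x \<alpha>))"
    by (rule sum.swap)
  moreover have "(\<Sum>\<alpha>\<in>UNIV. sigma d x j \<alpha> * (mu d x * kron \<alpha> n)) = mu d x * sigma d x j n"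
    by (simp add: mult.assoc[symmetric])
  ultimately show ?thesis
    unfolding cov_half_D cov_trace_def
    by (simp add: sum.distrib sum_distrib_left sum_distrib_right distrib_left distrib_right mult.assoc)
qed

lemma cov_half_D_divergence:
  "(\<Sum>\<alpha>\<in>UNIV. cov_12 L (half_D d) x \<alpha> j n \<alpha>) = cov_div L d x j n + real CARD('n) * mu d x * sigma d x j n"
proof -
  have "(\<Sum>\<alpha>\<in>UNIV. \<Sum>\<beta>\<in>UNIV. sigma d x j n * (torsion_part L x \<alpha> \<beta> \<alpha> * phi d x \<beta>))
    = (\<Sum>\<alpha>\<in>UNIV. \<Sum>\<beta>\<in>UNIV. sigma d x j n * (torsion_part L x \<beta> \<alpha> \<beta> * phi d x \<alpha>))"
    by (rule sum.swap)
  then show ?thesis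
    unfolding cov_half_D cov_div_def
    by (simp add: sum.distrib sum_distrib_left sum_distrib_right distrib_left distrib_right mult.assoc)
qed

text \<open>
  The \<open>\<mu>\<close>-terms and the connection terms are symmetric and cancel.
\<close>

lemma curl_sigma_phi:
  "cov_trace L d x m n - cov_trace L d x n m = pd n (\<lambda>y. sigma_phi d y m) x - pd m (\<lambda>y. sigma_phi d y n) x"
proof -
  have "cov_trace L d x m n + mu d x * sigma d x m n
    = pd n (\<lambda>y. sigma_phi d y m) x - (\<Sum>\<beta>\<in>UNIV. sym_part L x \<beta> m n * sigma_phi d x \<beta>)" for m n
    unfolding cov_half_D_trace[symmetric] cov_12_eq_cov_jet cov_jet_trace trace_half_D by (simp add: jet1_def)
  from this[of m n] this[of n m] show ?thesis
    by (simp add: sigma_commute[of m n] sym_part_commute[of L x _ m n])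
qed

lemma mean_jet_eq: "mean_jet (jet1 L x) (jet1 (D_tensor d) x) = mean_conn L d x"
  unfolding mean_jet_def half_jet_D jet1_sym_part[OF pi3_differentiable(1), symmetric] mean_conn_def ..

lemma mean_conn_commute: "fst (mean_conn L d x) i j k = fst (mean_conn L d x) i k j"
  by (simp add: fst_mean_conn sym_part_commute[of L x i j k] half_D_def sigma_commute[of j k])

text \<open>
  The first basic equation in terms of \<open>M\<close>: adding \<open>D\<close> to the symmetric part of \<open>L\<close> and subtracting half of it
  again leaves \<open>M\<close> up to the terms in \<open>\<psi>\<close>.
\<close>

lemma mean_jet_bar:
  "mean_jet (jet1 L' x) (jet1 (D_bar d) x)
     = proj_change (psi d x, \<lambda>j n. pd n (\<lambda>y. psi d y j) x) (mean_conn L d x)"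
proof -
  \<comment> \<open>The right-hand side of the first basic equation; it agrees with \<open>L'\<close> on \<open>U\<close>, hence has the same jet.\<close>
  define E where "E = (\<lambda>y i j k. sym_part L y i j k + psi d y j * kron i k + psi d y k * kron i j
          + 2 * (sigma d y j k * phi d y i))"
  have symd: "(\<lambda>y. sym_part L y i j k) differentiable at x" for i j k
    using differentiable_cmult_left_iff[of "1 / 2" "\<lambda>y. L y i j k + L y i k j" x] pi3_differentiable
    by (simp add: sym_part_def)
  have "sym_jet (jet1 L' x) = jet1 (sym_part L') x"
    by (rule jet1_sym_part[symmetric]) (rule pi3_differentiable)
  also have "\<dots> = jet1 E x"
    using map by (intro jet1_cong[OF pi3_open x]) (simp add: pi3_mapping_def E_def)
  finally have 1: "sym_jet (jet1 L' x) = jet1 E x" .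
  have 2: "pd n (\<lambda>y. E y i j k) x = pd n (\<lambda>y. sym_part L y i j k) x + pd n (\<lambda>y. psi d y j) x * kron i k
      + pd n (\<lambda>y. psi d y k) x * kron i j + 2 * pd n (\<lambda>y. half_D d y i j k) x" for i j k n
    by (simp add: E_def half_D_def pd_add pd_mult pd_const pi3_differentiable symd)
  have 3: "half_jet (jet1 (D_bar d) x) = (\<lambda>i j k. - half_D d x i j k, \<lambda>i j k n. - pd n (\<lambda>y. half_D d y i j k) x)"
  proof -
    have "D_bar d = (\<lambda>y i j k. - 2 * half_D d y i j k)"
      by (simp add: D_bar_def D_tensor_def half_D_def fun_eq_iff)
    moreover have "(\<lambda>y. half_D d y i j k) differentiable at x" for i j k
      by (simp add: half_D_def pi3_differentiable)
    ultimately show ?thesis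
      using pd_cmult[of "\<lambda>y. half_D d y i j k" x n "- 2" for i j k n]
      by (simp add: half_jet_def jet1_def fun_eq_iff)
  qed
  show ?thesis
    unfolding mean_conn_def unfolding mean_jet_def 1 3
    by (simp add: sum_jet_def proj_change_def jet1_def 2 fun_eq_iff) (simp add: E_def half_D_def)
qed

subsection \<open>The objects as projective invariants\<close>

lemma thomas_T_eq: "thomas_T L d x = fst (thomas_jet (mean_conn L d x))"
  unfolding thomas_jet_def proj_change_def fst_conv trace_mean_conn fst_mean_conn
  by (simp add: fun_eq_iff thomas_T_def half_D_def diff_divide_distrib add_divide_distrib algebra_simps)

text \<open>
  The next three lemmas evaluate bracket terms that are common to the formulas of several objects.
\<close>

lemma bracket_cov_trace:
  "(\<Sum>\<alpha>\<in>UNIV. (asym (\<lambda>m n. cov_02 L (sigma d) x m \<alpha> n) m n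
       + (\<Sum>\<beta>\<in>UNIV. asym (\<lambda>m n. sigma d x m \<beta> * torsion_part L x \<beta> \<alpha> n) m n)
       + asym (\<lambda>m n. sigma d x m \<alpha> * nu d x n) m n) * phi d x \<alpha>) = cov_trace L d x m n - cov_trace L d x n m"
  unfolding cov_trace_def asym_def by (simp add: expand_sums)

lemma bracket_sigma_sigma:
  "(\<Sum>\<alpha>\<in>UNIV. asym (\<lambda>m n. sigma d x j m * sigma d x \<alpha> n) m n * phi d x \<alpha> * phi d x i)
      = (sigma d x j m * sigma_phi d x n - sigma d x j n * sigma_phi d x m) * phi d x i"
  unfolding sigma_phi_def asym_def sigma_commute[of n] sigma_commute[of m] by (simp add: expand_sums)

lemma bracket_sigma_torsion:
  "(\<Sum>\<alpha>\<in>UNIV. asym (\<lambda>m n. sigma d x j m * torsion_part L x i \<alpha> n) m n * phi d x \<alpha>)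
      = sigma d x j m * (\<Sum>\<alpha>\<in>UNIV. torsion_part L x i \<alpha> n * phi d x \<alpha>)
        - sigma d x j n * (\<Sum>\<alpha>\<in>UNIV. torsion_part L x i \<alpha> m * phi d x \<alpha>)"
  unfolding asym_def by (simp add: expand_sums)

lemma curv_mean:
  "curv_jet (mean_conn L d x) i j m n = curv L x i j m n + cov_12 L (half_D d) x i j m n - cov_12 L (half_D d) x i j n m
     + (sigma d x j m * sigma_phi d x n - sigma d x j n * sigma_phi d x m) * phi d x i"
proof -
  have "(\<Sum>\<alpha>\<in>UNIV. half_D d x \<alpha> j m * half_D d x i \<alpha> n) = sigma d x j m * sigma_phi d x n * phi d x i" for m n
    by (simp add: half_D_def sigma_phi_def sum_distrib_left sum_distrib_right sigma_commute[of n] ac_simps)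
  then show ?thesis
    unfolding mean_conn_def curv_jet_sum_jet[OF jet1_sym_part_commute(1)] curv_eq_curv_jet[symmetric] cov_12_eq_cov_jet[symmetric]
    by (simp add: jet1_def left_diff_distrib)
qed

lemma ricci_mean:
  "ricci_jet (mean_conn L d x) j n = ricci L x j n + cov_div L d x j n - cov_trace L d x j n + (real CARD('n) - 1) * mu d x * sigma d x j n
     + sigma d x j n * (\<Sum>\<alpha>\<in>UNIV. sigma_phi d x \<alpha> * phi d x \<alpha>) - sigma_phi d x j * sigma_phi d x n"
proof -
  have "(\<Sum>\<alpha>\<in>UNIV. (sigma d x j n * sigma_phi d x \<alpha> - sigma d x j \<alpha> * sigma_phi d x n) * phi d x \<alpha>)
     = sigma d x j n * (\<Sum>\<alpha>\<in>UNIV. sigma_phi d x \<alpha> * phi d x \<alpha>) - sigma_phi d x j * sigma_phi d x n"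
    unfolding sigma_phi_def[of d x j]
    by (simp add: expand_sums)
  then show ?thesis
    unfolding ricci_jet_def curv_mean
    using cov_half_D_trace[of j n] cov_half_D_divergence[of j n]
    by (simp add: ricci_def sum.distrib sum_subtractf left_diff_distrib)
qed

text \<open>
  The Thomas parameter arises from \<open>M\<close> by the projective change with the covector
  \<open>-(L\<^sup>\<alpha>\<^sub>j\<^sub>\<alpha> + \<sigma>\<^sub>j\<^sub>\<alpha> \<phi>\<^sup>\<alpha>) / (N + 1)\<close>, where \<open>L\<close> stands for its symmetric part.  Its curvature
  is thus given by \<open>curv_jet_proj_change\<close>, and the terms of \<open>proj_schouten\<close> for this covector account for all
  terms with factors \<open>1 / (N + 1)\<close> and \<open>1 / (N + 1)\<^sup>2\<close>.
\<close>

lemma assoc_W_eq: "assoc_W L d x = curv_jet (thomas_jet (mean_conn L d x))"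
proof (intro ext)
  fix i j m n
  define a where "a = 1 / (real CARD('n) + 1)"
  define \<Lambda> where "\<Lambda> j n = (\<Sum>\<alpha>\<in>UNIV. cov_12 L (sym_part L) x \<alpha> j \<alpha> n)" for j n
  define z where "z = (\<Sum>\<alpha>\<in>UNIV. (contr_sym L x \<alpha> + sigma_phi d x \<alpha>) * phi d x \<alpha>)"
  note s = sigma_phi_def[of d x]
  have e1: "(\<Sum>\<alpha>\<in>UNIV. asym (\<lambda>m n. kron i m * cov_12 L (sym_part L) x \<alpha> j \<alpha> n) m n)
      = kron i m * \<Lambda> j n - kron i n * \<Lambda> j m"
    unfolding \<Lambda>_def asym_def by (simp add: sum_subtractf sum_distrib_left)
  have e2: "(\<Sum>\<alpha>\<in>UNIV. (asym (\<lambda>m n. kron i m * cov_02 L (sigma d) x j \<alpha> n) m n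
       + (\<Sum>\<beta>\<in>UNIV. asym (\<lambda>m n. kron i m * sigma d x j \<beta> * torsion_part L x \<beta> \<alpha> n) m n)
       + asym (\<lambda>m n. kron i m * sigma d x j \<alpha> * nu d x n) m n) * phi d x \<alpha>)
      = kron i m * cov_trace L d x j n - kron i n * cov_trace L d x j m"
    unfolding cov_trace_def asym_def by (simp add: expand_sums)
  have e3: "(\<Sum>\<alpha>\<in>UNIV. asym (\<lambda>m n. kron i m * sigma d x j n) m n
       * (contr_sym L x \<alpha> + (\<Sum>\<beta>\<in>UNIV. sigma d x \<alpha> \<beta> * phi d x \<beta>)) * phi d x \<alpha>)
      = (kron i m * sigma d x j n - kron i n * sigma d x j m) * z"
    unfolding z_def asym_def s by (simp add: sum_distrib_left mult.assoc)
  have e4: "(\<Sum>\<beta>\<in>UNIV. asym (\<lambda>m n. kron i m * sigma d x n \<beta>) m n * phi d x \<beta>)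
      = kron i m * sigma_phi d x n - kron i n * sigma_phi d x m"
    unfolding asym_def s by (simp add: left_diff_distrib sum_subtractf sum_distrib_left mult.assoc)
  \<comment> \<open>The trace of \<open>M\<close>, differentiated covariantly with respect to the symmetric part of \<open>L\<close>.\<close>
  have cov_tr: "snd (trace_jet (mean_conn L d x)) j n - (\<Sum>\<alpha>\<in>UNIV. sym_part L x \<alpha> j n * fst (trace_jet (mean_conn L d x)) \<alpha>)
      = \<Lambda> j n + cov_trace L d x j n + mu d x * sigma d x j n" for j n
    unfolding cov_half_D_trace[symmetric] add.assoc \<Lambda>_def cov_12_eq_cov_jet cov_jet_trace
    unfolding mean_conn_def
    by (simp add: trace_jet_def sum_jet_def sum.distrib distrib_left jet1_def)
  define q where "q = (\<lambda>j. - fst (trace_jet (mean_conn L d x)) j / (real CARD('n) + 1), \<lambda>j n. - snd (trace_jet (mean_conn L d x)) j n / (real CARD('n) + 1))"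
  have B: "proj_schouten q (mean_conn L d x) j n = - a * (\<Lambda> j n + cov_trace L d x j n + mu d x * sigma d x j n) + a * sigma d x j n * z
      - a\<^sup>2 * (contr_sym L x j + sigma_phi d x j) * (contr_sym L x n + sigma_phi d x n)" for j n
  proof -
    have "(\<Sum>\<alpha>\<in>UNIV. fst (mean_conn L d x) \<alpha> j n * fst q \<alpha>)
       = - a * (\<Sum>\<alpha>\<in>UNIV. sym_part L x \<alpha> j n * fst (trace_jet (mean_conn L d x)) \<alpha>) - a * sigma d x j n * z"
      unfolding z_def trace_mean_conn[symmetric]
      unfolding q_def a_def fst_mean_conn half_D_def fst_conv
      by (simp add: expand_sums sum_divide_distrib)
    then show ?thesis
      unfolding proj_schouten_def cov_tr[symmetric]
      by (simp add: q_def trace_mean_conn a_def power2_eq_square algebra_simps)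
  qed
  have ric: "asym (ricci L x) m n = \<Lambda> n m - \<Lambda> m n"
    unfolding asym_def ricci_eq_ricci_jet ricci_jet_antisym[OF jet1_sym_part_commute] \<Lambda>_def cov_12_eq_cov_jet cov_jet_trace
    by (simp add: jet1_sym_part_commute(1)[of L x _ m n])
  have C: "curv_jet (thomas_jet (mean_conn L d x)) i j m n = curv_jet (mean_conn L d x) i j m n
     + kron i j * (- a * (\<Lambda> m n + cov_trace L d x m n) + a * (\<Lambda> n m + cov_trace L d x n m))
     + kron i m * proj_schouten q (mean_conn L d x) j n - kron i n * proj_schouten q (mean_conn L d x) j m"
    unfolding thomas_jet_def q_def[symmetric] curv_jet_proj_change[OF mean_conn_commute] unfolding B
    by (simp add: sigma_commute[of m n] algebra_simps)
  have a2: "1 / (real CARD('n) + 1)\<^sup>2 = a\<^sup>2" by (simp add: a_def power_divide)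
  show "assoc_W L d x i j m n = curv_jet (thomas_jet (mean_conn L d x)) i j m n"
    unfolding assoc_W_def Let_def bracket_cov_trace bracket_sigma_sigma bracket_sigma_torsion
      e1 e2 e3 e4
    unfolding a2 a_def[symmetric] ric s[symmetric] C B curv_mean cov_half_D
    by (simp add: asym_def algebra_simps)
qed

lemma cov_div_commute: "cov_div L d x j n = cov_div L d x n j"
  unfolding cov_div_def cov_sigma_commute[of j n] sigma_commute[of j n] ..

text \<open>
  The \<open>\<mu>\<close>-terms of the curvature and of the Ricci tensor of \<open>M\<close> cancel in the Weyl tensor, which is why
  \<open>\<mu>\<close> is absent from \<open>weyl_W\<close>.
\<close>

lemma weyl_W_completed_eq: "weyl_W_completed L d x = weyl_jet (mean_conn L d x)"
proof (intro ext)
  fix i j m n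
  define N where "N = real CARD('n)"
  define a b c e where "a = 1 / (N + 1)" and "b = N / (N\<^sup>2 - 1)" and "c = 1 / (N\<^sup>2 - 1)" and "e = 1 / (N - 1)"
  \<comment> \<open>For symmetric tensors both Ricci terms combine to the factor \<open>e\<close>; \<open>e N - e = 1\<close> removes \<open>\<mu>\<close>.\<close>
  have be: "b + c = e" "e * N = e + 1"
  proof -
    have "N - 1 \<noteq> 0" "N + 1 \<noteq> 0" using pi3_card by (auto simp: N_def)
    moreover have "N\<^sup>2 - 1 = (N - 1) * (N + 1)" by (simp add: power2_eq_square algebra_simps)
    ultimately show "b + c = e" "e * N = e + 1"
      unfolding b_def c_def e_def by (simp_all add: divide_simps)
  qed
  have c_eq: "c = e - b" and Ne: "N * (e * X) = X + e * X" for X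
    using be by (simp_all add: mult.assoc[symmetric] mult.commute distrib_left)
  define z where "z = (\<Sum>\<alpha>\<in>UNIV. sigma_phi d x \<alpha> * phi d x \<alpha>)"
  note s = sigma_phi_def[of d x]
  have e1: "(\<Sum>\<alpha>\<in>UNIV. (asym (\<lambda>m n. kron i m * cov_02 L (sigma d) x j n \<alpha>) m n
       + (\<Sum>\<beta>\<in>UNIV. asym (\<lambda>m n. kron i m * sigma d x j n) m n * torsion_part L x \<beta> \<alpha> \<beta>)
       + asym (\<lambda>m n. kron i m * sigma d x j n) m n * nu d x \<alpha>) * phi d x \<alpha>)
      = kron i m * cov_div L d x j n - kron i n * cov_div L d x j m"
    unfolding cov_div_def asym_def by (simp add: expand_sums)
  have e2: "(\<Sum>\<alpha>\<in>UNIV. \<Sum>\<beta>\<in>UNIV. (asym (\<lambda>m n. kron i m * sigma d x j n) m n * sigma d x \<alpha> \<beta>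
       - asym (\<lambda>m n. kron i m * sigma d x j \<alpha> * sigma d x n \<beta>) m n) * phi d x \<alpha> * phi d x \<beta>)
      = (kron i m * sigma d x j n - kron i n * sigma d x j m) * z
        - (kron i m * (sigma_phi d x j * sigma_phi d x n) - kron i n * (sigma_phi d x j * sigma_phi d x m))"
    unfolding z_def s sum_product asym_def by (simp add: expand_sums)
  have e3: "(\<Sum>\<alpha>\<in>UNIV. (asym (\<lambda>m n. kron i m * cov_02 L (sigma d) x \<alpha> j n) m n
       + (\<Sum>\<beta>\<in>UNIV. asym (\<lambda>m n. kron i m * sigma d x \<beta> j * torsion_part L x \<beta> \<alpha> n) m n)
       + asym (\<lambda>m n. kron i m * sigma d x \<alpha> j * nu d x n) m n) * phi d x \<alpha>)
      = kron i m * cov_trace L d x j n - kron i n * cov_trace L d x j m"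
    unfolding cov_trace_def asym_def cov_sigma_commute[of _ j] sigma_commute[of _ j] by (simp add: expand_sums)
  have e4: "(\<Sum>\<alpha>\<in>UNIV. (asym (\<lambda>m n. kron i m * cov_02 L (sigma d) x \<alpha> n j) m n
       + (\<Sum>\<beta>\<in>UNIV. asym (\<lambda>m n. kron i m * sigma d x \<beta> n) m n * torsion_part L x \<beta> \<alpha> j)
       + asym (\<lambda>m n. kron i m * sigma d x \<alpha> n) m n * nu d x j) * phi d x \<alpha>)
      = kron i m * cov_trace L d x n j - kron i n * cov_trace L d x m j"
    unfolding cov_trace_def asym_def cov_sigma_commute[of n] sigma_commute[of n]
      cov_sigma_commute[of m] sigma_commute[of m] by (simp add: expand_sums)
  show "weyl_W_completed L d x i j m n = weyl_jet (mean_conn L d x) i j m n"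
    unfolding weyl_W_completed_def weyl_W_def weyl_jet_def Let_def bracket_cov_trace bracket_sigma_sigma bracket_sigma_torsion
      e1 e2 e3 e4
    unfolding ricci_mean curv_mean cov_half_D N_def[symmetric]
      a_def[symmetric] b_def[symmetric] c_def[symmetric] e_def[symmetric] z_def[symmetric]
      c_eq asym_def sigma_commute[of n m] sigma_commute[of n j] sigma_commute[of m j]
      cov_div_commute[of n m] cov_div_commute[of n j] cov_div_commute[of m j]
    by (simp add: algebra_simps Ne)
qed

end

section \<open>The inverse mapping\<close>

text \<open>
  The pair \<open>(-\<sigma>, \<phi>)\<close> is one choice of factors of \<open>-D\<close>; \<open>\<nu>\<close> and \<open>\<mu>\<close> then absorb the change of the
  covariant derivative of \<open>\<phi>\<close>.
\<close>

definition inverse_data :: "'n::finite pi3_data \<Rightarrow> 'n pi3_data" where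
  "inverse_data d = \<lparr>psi = (\<lambda>x j. - psi d x j), sigma = (\<lambda>x j k. - sigma d x j k), phi = phi d,
     nu = (\<lambda>x j. nu d x j + psi d x j + 2 * sigma_phi d x j),
     mu = (\<lambda>x. mu d x + (\<Sum>\<alpha>\<in>UNIV. psi d x \<alpha> * phi d x \<alpha>))\<rparr>"

text \<open>
  For equal torsion, \<open>L'\<^sup>i\<^sub>j\<^sub>\<alpha> \<phi>\<^sup>\<alpha> - L\<^sup>i\<^sub>j\<^sub>\<alpha> \<phi>\<^sup>\<alpha> = (\<psi>\<^sub>j + 2 \<sigma>\<^sub>j\<^sub>\<alpha> \<phi>\<^sup>\<alpha>) \<phi>\<^sup>i + \<psi>\<^sub>\<alpha> \<phi>\<^sup>\<alpha> \<delta>\<^sup>i\<^sub>j\<close>, which has the form allowed by the second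
  basic equation.
\<close>

lemma corresponding_inverse_data:
  assumes map: "pi3_mapping U L L' d" and eqt: "equitorsion U L L'"
  shows "corresponding_data U L L' d (inverse_data d)"
proof -
  have oU: "open U" and sd: "smooth_data U d" using map by (auto simp: pi3_mapping_def GA_space_def)
  have smooth: "smooth_data U (inverse_data d)"
    using sd unfolding smooth_data_def inverse_data_def sigma_phi_def
    by (auto intro!: oU smooth_on_add smooth_on_mult smooth_on_sum smooth_on_minus smooth_on_const)
  have vec: "cov2_vec L' (phi d) x i j
      = (nu d x j + psi d x j + 2 * sigma_phi d x j) * phi d x i
        + (mu d x + (\<Sum>\<alpha>\<in>UNIV. psi d x \<alpha> * phi d x \<alpha>)) * kron i j" if x: "x \<in> U" for x i j
  proof -
    have "L' x i j \<alpha> = L x i j \<alpha> + psi d x j * kron i \<alpha> + psi d x \<alpha> * kron i j + 2 * sigma d x j \<alpha> * phi d x i" for \<alpha>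
    proof -
      have "L' x i j \<alpha> = sym_part L' x i j \<alpha> + torsion_part L' x i j \<alpha>"
        "L x i j \<alpha> = sym_part L x i j \<alpha> + torsion_part L x i j \<alpha>"
        by (simp_all add: sym_part_def torsion_part_def field_simps)
      then show ?thesis
        using map eqt x by (simp add: pi3_mapping_def equitorsion_def)
    qed
    then have "(\<Sum>\<alpha>\<in>UNIV. L' x i j \<alpha> * phi d x \<alpha>)
        = (\<Sum>\<alpha>\<in>UNIV. L x i j \<alpha> * phi d x \<alpha> + psi d x j * (kron i \<alpha> * phi d x \<alpha>)
            + kron i j * (psi d x \<alpha> * phi d x \<alpha>) + 2 * phi d x i * (sigma d x j \<alpha> * phi d x \<alpha>))"
      by (simp add: algebra_simps)
    also have "\<dots> = (\<Sum>\<alpha>\<in>UNIV. L x i j \<alpha> * phi d x \<alpha>) + psi d x j * phi d x i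
            + kron i j * (\<Sum>\<alpha>\<in>UNIV. psi d x \<alpha> * phi d x \<alpha>) + 2 * phi d x i * sigma_phi d x j"
      by (simp only: sum.distrib sum_distrib_left[symmetric] sum_kron sigma_phi_def)
    finally have "cov2_vec L' (phi d) x i j = cov2_vec L (phi d) x i j + psi d x j * phi d x i
            + kron i j * (\<Sum>\<alpha>\<in>UNIV. psi d x \<alpha> * phi d x \<alpha>) + 2 * phi d x i * sigma_phi d x j"
      by (simp add: cov2_vec_def)
    then show ?thesis
      using map x by (simp add: pi3_mapping_def algebra_simps)
  qed
  have "pi3_mapping U L' L (inverse_data d)"
    unfolding pi3_mapping_def
    using map smooth vec by (simp add: pi3_mapping_def inverse_data_def)
  then show ?thesis
    by (simp add: corresponding_data_def D_bar_def D_tensor_def inverse_data_def)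
qed

lemma reciprocity_equitorsion:
  "pi3_mapping U L L' d \<Longrightarrow> equitorsion U L L' \<Longrightarrow> reciprocity U L L'"
  using corresponding_inverse_data unfolding reciprocity_def corresponding_data_def by blast

text \<open>
  Although the factors of \<open>D\<close> are not unique, \<open>\<sigma>\<^sub>j\<^sub>\<alpha> \<phi>\<^sup>\<alpha>\<close> is a trace of \<open>D / 2\<close> and so is determined by it.
\<close>

lemma sigma_phi_corresponding:
  assumes "corresponding_data U L L' d d'" "x \<in> U"
  shows "sigma_phi d' x j = - sigma_phi d x j"
proof -
  have "2 * sigma d' x j \<alpha> * phi d' x \<alpha> = - (2 * sigma d x j \<alpha> * phi d x \<alpha>)" for \<alpha>
    using assms unfolding corresponding_data_def D_bar_def D_tensor_def by blast
  then have "sigma d' x j \<alpha> * phi d' x \<alpha> = - (sigma d x j \<alpha> * phi d x \<alpha>)" for \<alpha>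
    unfolding mult.assoc by (metis mult_minus_right mult_left_cancel zero_neq_numeral)
  then show ?thesis
    unfolding sigma_phi_def sum_negf[symmetric] by (intro sum.cong) auto
qed

lemma pd_sigma_phi_corresponding:
  assumes map: "pi3_mapping U L L' d" and d': "corresponding_data U L L' d d'" and x: "x \<in> U"
  shows "pd n (\<lambda>y. sigma_phi d' y m) x = - pd n (\<lambda>y. sigma_phi d y m) x"
proof -
  have "(\<lambda>y. sigma_phi d y m) differentiable at x"
    unfolding sigma_phi_def by (intro differentiable_sum differentiable_mult ballI finite pi3_differentiable[OF map x])
  then have "pd n (\<lambda>y. - 1 * sigma_phi d y m) x = - pd n (\<lambda>y. sigma_phi d y m) x"
    by (simp only: pd_cmult)
  moreover have "pd n (\<lambda>y. sigma_phi d' y m) x = pd n (\<lambda>y. - 1 * sigma_phi d y m) x"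
    using sigma_phi_corresponding[OF d'] by (intro pd_cong[OF pi3_open[OF map x] x]) simp
  ultimately show ?thesis by simp
qed

section \<open>A criterion for invariance\<close>

text \<open>
  The object is a function \<open>\<Phi>\<close> of the jets of the connection and of \<open>D\<close>, hence independent of how \<open>D\<close> is
  factored, and \<open>\<Phi>\<close> takes the same value on the target connection and \<open>-D\<close>.
  This yields both kinds of invariance: \<open>\<Phi>\<close> is a formula as required for valued invariance, and for
  all barred data it computes the object of the inverse mapping.
\<close>

definition jet_invariant :: "('n::finite, 'c) geom_object \<Rightarrow> ('n jet \<Rightarrow> 'n jet \<Rightarrow> 'c) \<Rightarrow> bool" where
  "jet_invariant F \<Phi> \<longleftrightarrow> (\<forall>U L L' d. pi3_mapping U L L' d \<and> equitorsion U L L' \<longrightarrow> (\<forall>x\<in>U.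
     F L d x = \<Phi> (jet1 L x) (jet1 (D_tensor d) x) \<and>
     \<Phi> (jet1 L' x) (jet1 (D_bar d) x) = \<Phi> (jet1 L x) (jet1 (D_tensor d) x)))"

lemma jet_invariant_valued: "jet_invariant F \<Phi> \<Longrightarrow> valued_invariant F"
  unfolding jet_invariant_def valued_invariant_def by metis

lemma jet_invariant_corresponding:
  assumes F: "jet_invariant F \<Phi>" and map: "pi3_mapping U L L' d" and eqt: "equitorsion U L L'"
    and d': "corresponding_data U L L' d d'" and x: "x \<in> U"
  shows "F L' d' x = F L d x"
proof -
  have "pi3_mapping U L' L d'" "equitorsion U L' L"
    using d' eqt by (auto simp: corresponding_data_def equitorsion_def)
  then have "F L' d' x = \<Phi> (jet1 L' x) (jet1 (D_tensor d') x)"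
    using F x unfolding jet_invariant_def by metis
  also have "jet1 (D_tensor d') x = jet1 (D_bar d) x"
    using d' by (intro jet1_cong[OF pi3_open[OF map x] x]) (simp add: corresponding_data_def)
  also have "\<Phi> (jet1 L' x) \<dots> = F L d x"
    using F x map eqt unfolding jet_invariant_def by metis
  finally show ?thesis .
qed

lemma jet_invariant_total:
  assumes "jet_invariant F \<Phi>" "pi3_mapping U L L' d" "equitorsion U L L'"
  shows "total_invariant U L L' d F"
  unfolding total_invariant_def
  using corresponding_inverse_data[OF assms(2,3)] jet_invariant_corresponding[OF assms] by blast

text \<open>
  The exterior derivative of \<open>\<sigma>\<^sub>m\<^sub>\<alpha> \<phi>\<^sup>\<alpha>\<close> as a function of the jet of \<open>D\<close>.
\<close>

definition curl_jet :: "'n::finite jet \<Rightarrow> 'n \<Rightarrow> 'n \<Rightarrow> real" where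
  "curl_jet K m n = snd (trace_jet (half_jet K)) m n - snd (trace_jet (half_jet K)) n m"

text \<open>
  The formula in the target objects carries the exterior derivative with the opposite sign, since it is
  evaluated on \<open>-D\<close>.
\<close>

lemma curl_defect_valued:
  fixes F G :: "'n::finite geom_object4"
  assumes G: "jet_invariant G \<Phi>"
    and F: "\<And>U L L' d x i j m n. pi3_mapping U L L' d \<Longrightarrow> x \<in> U \<Longrightarrow>
      F L d x i j m n = G L d x i j m n
        + c * kron i j * (pd n (\<lambda>y. sigma_phi d y m) x - pd m (\<lambda>y. sigma_phi d y n) x)"
  shows "valued_invariant F"
  unfolding valued_invariant_def
proof (intro exI[of _ "\<lambda>J K i j m n. \<Phi> J K i j m n - c * kron i j * curl_jet K m n"] allI impI ballI)
  fix U L L' d x assume a: "pi3_mapping U L L' d \<and> equitorsion U L L'" and x: "(x::real^'n) \<in> U"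
  then have map: "pi3_mapping U L L' d" by simp
  have cor: "corresponding_data U L L' d (inverse_data d)"
    using corresponding_inverse_data a by blast
  then have inv: "pi3_mapping U L' L (inverse_data d)"
    by (simp add: corresponding_data_def)
  have "D_bar d = D_tensor (inverse_data d)"
    by (simp add: D_bar_def D_tensor_def inverse_data_def fun_eq_iff)
  then have curl: "curl_jet (jet1 (D_bar d) x) m n
      = - (pd n (\<lambda>y. sigma_phi d y m) x - pd m (\<lambda>y. sigma_phi d y n) x)" for m n
    by (simp add: curl_jet_def half_jet_D[OF inv x] trace_half_D[OF inv x] pd_sigma_phi_corresponding[OF map cor x])
  have "\<Phi> (jet1 L' x) (jet1 (D_bar d) x) = G L d x"
    using G a x unfolding jet_invariant_def by metis
  then show "(\<lambda>i j m n. \<Phi> (jet1 L' x) (jet1 (D_bar d) x) i j m n - c * kron i j * curl_jet (jet1 (D_bar d) x) m n)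
     = F L d x"
    unfolding curl by (simp add: fun_eq_iff F[OF map x] algebra_simps)
qed

text \<open>
  Replacing the data by barred data changes the object by twice the exterior derivative; the components with
  \<open>i = j\<close> detect it.
\<close>

lemma curl_defect_total:
  fixes F G :: "'n::finite geom_object4"
  assumes G: "jet_invariant G \<Phi>" and c: "c \<noteq> 0"
    and F: "\<And>U L L' d x i j m n. pi3_mapping U L L' d \<Longrightarrow> x \<in> U \<Longrightarrow>
      F L d x i j m n = G L d x i j m n
        + c * kron i j * (pd n (\<lambda>y. sigma_phi d y m) x - pd m (\<lambda>y. sigma_phi d y n) x)"
    and map: "pi3_mapping U L L' d" and eqt: "equitorsion U L L'"
  shows "total_invariant U L L' d F \<longleftrightarrow> sigma_phi_closed U d"
proof -
  define curl where "curl x m n = pd n (\<lambda>y. sigma_phi d y m) x - pd m (\<lambda>y. sigma_phi d y n) x" for x m n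
  have change: "F L' d' x i j m n = F L d x i j m n - 2 * c * kron i j * curl x m n"
    if d': "corresponding_data U L L' d d'" and x: "x \<in> U" for d' x i j m n
  proof -
    have map': "pi3_mapping U L' L d'" using d' by (simp add: corresponding_data_def)
    show ?thesis
      unfolding F[OF map x] F[OF map' x] jet_invariant_corresponding[OF G map eqt d' x]
        pd_sigma_phi_corresponding[OF map d' x] curl_def
      by (simp add: algebra_simps)
  qed
  have closed: "sigma_phi_closed U d \<longleftrightarrow> (\<forall>x\<in>U. \<forall>m n. curl x m n = 0)"
    by (simp add: sigma_phi_closed_def curl_def)
  show ?thesis
  proof
    assume tot: "total_invariant U L L' d F"
    note d' = corresponding_inverse_data[OF map eqt]
    have "curl x m n = 0" if x: "x \<in> U" for x m n
    proof -
      have "F L' (inverse_data d) x = F L d x" using tot d' x unfolding total_invariant_def by blast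
      then show ?thesis using change[OF d' x, of i i m n for i] c by simp
    qed
    then show "sigma_phi_closed U d" by (simp add: closed)
  next
    assume "sigma_phi_closed U d"
    then have "F L' d' x = F L d x" if "corresponding_data U L L' d d'" "x \<in> U" for d' x
      using change[OF that] that(2) by (simp add: closed fun_eq_iff)
    then show "total_invariant U L L' d F"
      unfolding total_invariant_def using corresponding_inverse_data[OF map eqt] by blast
  qed
qed

section \<open>Invariance of the individual objects\<close>

lemma thomas_mean_bar:
  assumes "pi3_mapping U L L' d" "x \<in> U"
  shows "thomas_jet (mean_jet (jet1 L' x) (jet1 (D_bar d) x)) = thomas_jet (mean_conn L d x)"
  by (simp add: mean_jet_bar[OF assms] thomas_jet_proj_change)

lemma jet_invariant_thomas_T:
  "jet_invariant (thomas_T :: ('n::finite, _) geom_object) (\<lambda>J K. fst (thomas_jet (mean_jet J K)))"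
  unfolding jet_invariant_def using thomas_T_eq mean_jet_eq thomas_mean_bar by metis

lemma jet_invariant_assoc_W:
  "jet_invariant (assoc_W :: 'n::finite geom_object4) (\<lambda>J K. curv_jet (thomas_jet (mean_jet J K)))"
  unfolding jet_invariant_def using assoc_W_eq mean_jet_eq thomas_mean_bar by metis

lemma jet_invariant_weyl_W_completed:
  "jet_invariant (weyl_W_completed :: 'n::finite geom_object4) (\<lambda>J K. weyl_jet (mean_jet J K))"
  unfolding jet_invariant_def
proof (intro allI impI ballI)
  fix U L L' d x assume a: "pi3_mapping U L L' d \<and> equitorsion U L L'" and x: "(x::real^'n) \<in> U"
  then have map: "pi3_mapping U L L' d" by simp
  show "weyl_W_completed L d x = weyl_jet (mean_jet (jet1 L x) (jet1 (D_tensor d) x)) \<and>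
    weyl_jet (mean_jet (jet1 L' x) (jet1 (D_bar d) x)) = weyl_jet (mean_jet (jet1 L x) (jet1 (D_tensor d) x))"
    unfolding weyl_W_completed_eq[OF map x] mean_jet_eq[OF map x] mean_jet_bar[OF map x]
    using weyl_jet_proj_change[OF mean_conn_commute[OF map x] pi3_card[OF map x]] by (simp add: fun_eq_iff)
qed

text \<open>
  Here \<open>T\<close> is the jet of the torsion and \<open>X\<close> the Thomas parameter.  Selecting the connection itself cancels
  the connection terms of the covariant derivative; selecting \<open>\<omega>\<close> leaves the difference, which is \<open>X\<close>.
\<close>

definition torsion_terms_jet ::
  "real \<Rightarrow> real \<Rightarrow> (nat \<Rightarrow> nat) \<Rightarrow> (nat \<Rightarrow> nat) \<Rightarrow> 'n::finite jet \<Rightarrow> ('n \<Rightarrow> 'n \<Rightarrow> 'n \<Rightarrow> real)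
    \<Rightarrow> 'n \<Rightarrow> 'n \<Rightarrow> 'n \<Rightarrow> 'n \<Rightarrow> real" where
  "torsion_terms_jet u u' p1 p2 T X i j m n =
    (let t = fst T; t' = snd T; w = (\<lambda>p. if p = 1 then (\<lambda>i j k. 0) else X) in
      u * (t' i j m n + (\<Sum>\<alpha>\<in>UNIV. w (p1 1) i \<alpha> n * t \<alpha> j m)
           - (\<Sum>\<alpha>\<in>UNIV. w (p1 2) \<alpha> j n * t i \<alpha> m) - (\<Sum>\<alpha>\<in>UNIV. w (p1 3) \<alpha> m n * t i j \<alpha>))
      + u' * (t' i j n m + (\<Sum>\<alpha>\<in>UNIV. w (p2 1) i \<alpha> m * t \<alpha> j n)
           - (\<Sum>\<alpha>\<in>UNIV. w (p2 2) \<alpha> j m * t i \<alpha> n) - (\<Sum>\<alpha>\<in>UNIV. w (p2 3) \<alpha> m n * t i j \<alpha>)))"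

lemma torsion_terms_eq:
  "torsion_terms u u' p1 p2 L d x = torsion_terms_jet u u' p1 p2 (jet1 (torsion_part L) x) (thomas_T L d x)"
proof (intro ext)
  fix i j m n
  have w: "sym_part L x i j k - omega_sel p L d x i j k = (if p = 1 then \<lambda>i j k. 0 else thomas_T L d x) i j k" for p i j k
    by (simp add: omega_sel_def omega_def thomas_T_def)
  have w': "(\<Sum>\<alpha>\<in>UNIV. (if p = 1 then \<lambda>i j k. 0 else thomas_T L d x) (f \<alpha>) (g \<alpha>) (h \<alpha>) * t \<alpha>)
    = (\<Sum>\<alpha>\<in>UNIV. sym_part L x (f \<alpha>) (g \<alpha>) (h \<alpha>) * t \<alpha>) - (\<Sum>\<alpha>\<in>UNIV. omega_sel p L d x (f \<alpha>) (g \<alpha>) (h \<alpha>) * t \<alpha>)"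
    for p f g h and t :: "'a \<Rightarrow> real"
    by (simp only: w[symmetric] left_diff_distrib sum_subtractf)
  show "torsion_terms u u' p1 p2 L d x i j m n = torsion_terms_jet u u' p1 p2 (jet1 (torsion_part L) x) (thomas_T L d x) i j m n"
    unfolding torsion_terms_def torsion_terms_jet_def Let_def cov_12_def
      w'[of _ "\<lambda>_. i" "\<lambda>\<alpha>. \<alpha>" "\<lambda>_. n"] w'[of _ "\<lambda>_. i" "\<lambda>\<alpha>. \<alpha>" "\<lambda>_. m"]
      w'[of _ "\<lambda>\<alpha>. \<alpha>" "\<lambda>_. j" "\<lambda>_. n"] w'[of _ "\<lambda>\<alpha>. \<alpha>" "\<lambda>_. j" "\<lambda>_. m"] w'[of _ "\<lambda>\<alpha>. \<alpha>" "\<lambda>_. m" "\<lambda>_. n"]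
    by (simp add: jet1_def sym_part_commute[of L x _ m n] algebra_simps)
qed

lemma jet_invariant_with_torsion:
  fixes F :: "'n::finite geom_object4"
  assumes F: "jet_invariant F \<Phi>"
  shows "jet_invariant (with_torsion F u u' p1 p2) (\<lambda>J K i j m n. \<Phi> J K i j m n
    + torsion_terms_jet u u' p1 p2 (tors_jet J) (fst (thomas_jet (mean_jet J K))) i j m n)"
  unfolding jet_invariant_def
proof (intro allI impI ballI)
  fix U L L' d x assume a: "pi3_mapping U L L' d \<and> equitorsion U L L'" and x: "(x::real^'n) \<in> U"
  then have map: "pi3_mapping U L L' d" by simp
  have t: "jet1 (torsion_part L) x = tors_jet (jet1 L x)" "jet1 (torsion_part L') x = tors_jet (jet1 L' x)"
    using pi3_differentiable[OF map x] by (auto intro: jet1_torsion_part)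
  have "jet1 (torsion_part L') x = jet1 (torsion_part L) x"
    using a by (intro jet1_cong[OF pi3_open[OF map x] x]) (simp add: equitorsion_def)
  then have t': "tors_jet (jet1 L' x) = tors_jet (jet1 L x)" by (simp add: t)
  have f: "F L d x = \<Phi> (jet1 L x) (jet1 (D_tensor d) x)"
    "\<Phi> (jet1 L' x) (jet1 (D_bar d) x) = \<Phi> (jet1 L x) (jet1 (D_tensor d) x)"
    using F a x unfolding jet_invariant_def by metis+
  show "with_torsion F u u' p1 p2 L d x = (\<lambda>i j m n. \<Phi> (jet1 L x) (jet1 (D_tensor d) x) i j m n
      + torsion_terms_jet u u' p1 p2 (tors_jet (jet1 L x)) (fst (thomas_jet (mean_jet (jet1 L x) (jet1 (D_tensor d) x)))) i j m n) \<and>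
    (\<lambda>i j m n. \<Phi> (jet1 L' x) (jet1 (D_bar d) x) i j m n
      + torsion_terms_jet u u' p1 p2 (tors_jet (jet1 L' x)) (fst (thomas_jet (mean_jet (jet1 L' x) (jet1 (D_bar d) x)))) i j m n)
    = (\<lambda>i j m n. \<Phi> (jet1 L x) (jet1 (D_tensor d) x) i j m n
      + torsion_terms_jet u u' p1 p2 (tors_jet (jet1 L x)) (fst (thomas_jet (mean_jet (jet1 L x) (jet1 (D_tensor d) x)))) i j m n)"
    by (simp add: fun_eq_iff with_torsion_def f torsion_terms_eq t t' thomas_T_eq[OF map x] thomas_mean_bar[OF map x] mean_jet_eq[OF map x])
qed

text \<open>
  By \<open>curl_sigma_phi\<close>, the term added in the completion is an exterior derivative.
\<close>

lemma weyl_W_defect: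
  fixes L :: "'n::finite conn"
  assumes map: "pi3_mapping U L L' d" and x: "x \<in> U"
  shows "weyl_W L d x i j m n = weyl_W_completed L d x i j m n + 1 / (real CARD('n) + 1) * kron i j
    * (pd n (\<lambda>y. sigma_phi d y m) x - pd m (\<lambda>y. sigma_phi d y n) x)"
  unfolding weyl_W_completed_def Let_def bracket_cov_trace[OF map x] curl_sigma_phi[OF map x] by simp

lemma with_torsion_weyl_W_defect:
  fixes L :: "'n::finite conn"
  assumes map: "pi3_mapping U L L' d" and x: "x \<in> U"
  shows "with_torsion weyl_W u u' p1 p2 L d x i j m n = with_torsion weyl_W_completed u u' p1 p2 L d x i j m n
    + 1 / (real CARD('n) + 1) * kron i j * (pd n (\<lambda>y. sigma_phi d y m) x - pd m (\<lambda>y. sigma_phi d y n) x)"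
  unfolding with_torsion_def weyl_W_defect[OF map x] by simp

theorem theorem3p2:
  fixes U :: "(real ^ 'n::finite) set" and L L' :: "'n conn" and d :: "'n pi3_data"
  assumes "pi3_mapping U L L' d" and "equitorsion U L L'"
  shows
    "total_invariant U L L' d thomas_T \<and>

     (valued_invariant (assoc_W :: 'n geom_object4) \<and>
      (total_invariant U L L' d assoc_W \<longleftrightarrow> reciprocity U L L')) \<and>

     (valued_invariant (weyl_W :: 'n geom_object4) \<and>
      (total_invariant U L L' d weyl_W \<longleftrightarrow> reciprocity U L L' \<and> sigma_phi_closed U d) \<and>
      valued_invariant (weyl_W_completed :: 'n geom_object4) \<and>
      (total_invariant U L L' d weyl_W_completed \<longleftrightarrow> reciprocity U L L')) \<and>

     (\<forall>(u::real) (u'::real) p1 p2. (\<forall>b\<in>{1,2,3}. p1 b \<in> {1,2} \<and> p2 b \<in> {1,2}) \<longrightarrow>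
        valued_invariant (with_torsion assoc_W u u' p1 p2 :: 'n geom_object4) \<and>
        (total_invariant U L L' d (with_torsion assoc_W u u' p1 p2) \<longleftrightarrow> reciprocity U L L') \<and>
        valued_invariant (with_torsion weyl_W u u' p1 p2 :: 'n geom_object4) \<and>
        (total_invariant U L L' d (with_torsion weyl_W u u' p1 p2)
           \<longleftrightarrow> reciprocity U L L' \<and> sigma_phi_closed U d) \<and>
        valued_invariant (with_torsion weyl_W_completed u u' p1 p2 :: 'n geom_object4) \<and>
        (total_invariant U L L' d (with_torsion weyl_W_completed u u' p1 p2)
           \<longleftrightarrow> reciprocity U L L'))"
proof -
  have rec: "reciprocity U L L'" by (rule reciprocity_equitorsion[OF assms])
  have c: "1 / (real CARD('n) + 1) \<noteq> 0" by (simp add: add_nonneg_eq_0_iff)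
  note total = jet_invariant_total[OF _ assms] and valued = jet_invariant_valued
  note assoc = jet_invariant_assoc_W and completed = jet_invariant_weyl_W_completed
  note tors = jet_invariant_with_torsion
  note weyl_valued = curl_defect_valued[OF completed weyl_W_defect]
    curl_defect_valued[OF tors[OF completed] with_torsion_weyl_W_defect]
  note weyl_total = curl_defect_total[OF completed c weyl_W_defect assms]
    curl_defect_total[OF tors[OF completed] c with_torsion_weyl_W_defect assms]
  show ?thesis
    by (simp add: rec total[OF jet_invariant_thomas_T] total[OF assoc] total[OF completed]
        total[OF tors[OF assoc]] total[OF tors[OF completed]]
        valued[OF assoc] valued[OF completed] valued[OF tors[OF assoc]] valued[OF tors[OF completed]]
        weyl_valued weyl_total)
qed

end
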